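(* Let $(M,g)$ be a smooth compact Riemannian manifold (without boundary). For every integer $N\ge 1$, all points $x_1,\dots,x_N\in M$ and all $t>0$, $$ \frac{1}{N^2}\sum_{m,n=1}^{N} [e^{t\Delta}\delta_{x_m}](x_n) \geq \frac{1}{\operatorname{vol}(M)}.$$
   Context: $\Delta=\Delta_g$ is the Laplace-Beltrami operator of $(M,g)$ (with the sign convention that $-\Delta_g$ has nonnegative spectrum), $\operatorname{vol}$ is the Riemannian volume measure, and $e^{t\Delta}$, $t>0$, is the heat semigroup. For $x\in M$, $e^{t\Delta}\delta_x$ is the solution at time $t$ of the heat equation $(\partial_t-\Delta_g)u=0$ on $M$ with initial datum the Dirac measure at $x$, so $[e^{t\Delta}\delta_x](y)$ is the heat kernel $p_t(x,y)$ of $(M,g)$. *)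

theory Defs
  imports "HOL-Analysis.Analysis"
begin

text \<open>
  A manifold is a topological space \<open>'m\<close> with an atlas of charts into \<open>\<real>\<^sup>n\<close>, where
  \<open>n = CARD('n) \<ge> 1\<close>. Tensors and differential operators are given by their coordinate
  expressions in all charts of the atlas.
\<close>


section \<open>Smooth maps\<close>

text \<open>Intended for open \<open>S\<close> and finite-dimensional \<open>'a\<close>.\<close>

primrec Ck_on :: "nat \<Rightarrow> ('a::real_normed_vector \<Rightarrow> 'b::real_normed_vector) \<Rightarrow> 'a set \<Rightarrow> bool" where
  "Ck_on 0 f S \<longleftrightarrow> continuous_on S f"
| "Ck_on (Suc k) f S \<longleftrightarrow>
     (\<forall>x\<in>S. f differentiable (at x)) \<and>
     (\<forall>v. Ck_on k (\<lambda>x. frechet_derivative f (at x) v) S)"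

definition smooth_on :: "'a set \<Rightarrow> ('a::real_normed_vector \<Rightarrow> 'b::real_normed_vector) \<Rightarrow> bool" where
  "smooth_on S f \<longleftrightarrow> (\<forall>k. Ck_on k f S)"


section \<open>Smooth manifolds\<close>

text \<open>A chart is an open set together with its coordinate map, whose values outside that set are
  irrelevant.\<close>

type_synonym ('m, 'n) chart = "'m set \<times> ('m \<Rightarrow> real ^ 'n)"

abbreviation chart_domain :: "('m, 'n::finite) chart \<Rightarrow> 'm set" where
  "chart_domain c \<equiv> fst c"

abbreviation coords :: "('m, 'n::finite) chart \<Rightarrow> 'm \<Rightarrow> real ^ 'n" where
  "coords c \<equiv> snd c"

definition chart_range :: "('m, 'n::finite) chart \<Rightarrow> (real ^ 'n) set" where
  "chart_range c = coords c ` chart_domain c"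

definition chart_inv :: "('m, 'n::finite) chart \<Rightarrow> real ^ 'n \<Rightarrow> 'm" where
  "chart_inv c = inv_into (chart_domain c) (coords c)"

definition is_chart :: "('m::topological_space, 'n::finite) chart \<Rightarrow> bool" where
  "is_chart c \<longleftrightarrow> open (chart_domain c) \<and> open (chart_range c) \<and>
     homeomorphism (chart_domain c) (chart_range c) (coords c) (chart_inv c)"

definition transition :: "('m, 'n::finite) chart \<Rightarrow> ('m, 'n) chart \<Rightarrow> real ^ 'n \<Rightarrow> real ^ 'n" where
  "transition c d = coords d \<circ> chart_inv c"

definition smooth_atlas :: "('m::topological_space, 'n::finite) chart set \<Rightarrow> bool" where
  "smooth_atlas A \<longleftrightarrow>
     (\<forall>c\<in>A. is_chart c) \<and> (\<Union>c\<in>A. chart_domain c) = UNIV \<and>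
     (\<forall>c\<in>A. \<forall>d\<in>A. smooth_on (coords c ` (chart_domain c \<inter> chart_domain d)) (transition c d))"

text \<open>Second countability is not required separately: it follows from compactness and the
  existence of charts.\<close>

definition compact_smooth_manifold :: "('m::t2_space, 'n::finite) chart set \<Rightarrow> bool" where
  "compact_smooth_manifold A \<longleftrightarrow> smooth_atlas A \<and> compact (UNIV :: 'm set)"


section \<open>Riemannian metrics\<close>

text \<open>\<open>g c x\<close> is the matrix \<open>(g\<^sub>i\<^sub>j)\<close> of the metric in the chart \<open>c\<close> at the coordinate point \<open>x\<close>.
  The last condition is the transformation law of a covariant 2-tensor.\<close>

type_synonym ('m, 'n) metric = "('m, 'n) chart \<Rightarrow> real ^ 'n \<Rightarrow> real ^ 'n ^ 'n"

definition riemannian_metric ::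
  "('m::topological_space, 'n::finite) chart set \<Rightarrow> ('m, 'n) metric \<Rightarrow> bool" where
  "riemannian_metric A g \<longleftrightarrow>
     (\<forall>c\<in>A. smooth_on (chart_range c) (g c)) \<and>
     (\<forall>c\<in>A. \<forall>x\<in>chart_range c.
        transpose (g c x) = g c x \<and> (\<forall>v. v \<noteq> 0 \<longrightarrow> v \<bullet> (g c x *v v) > 0)) \<and>
     (\<forall>c\<in>A. \<forall>d\<in>A. \<forall>p\<in>chart_domain c \<inter> chart_domain d.
        let J = matrix (frechet_derivative (transition c d) (at (coords c p)))
        in g c (coords c p) = transpose J ** g d (coords d p) ** J)"

text \<open>A measure satisfying this exists for every Riemannian metric and is unique, since the chart
  domains cover the manifold.\<close>

definition riemannian_volume ::
  "('m::topological_space, 'n::finite) chart set \<Rightarrow> ('m, 'n) metric \<Rightarrow> 'm measure \<Rightarrow> bool" where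
  "riemannian_volume A g vol \<longleftrightarrow>
     sets vol = sets borel \<and>
     (\<forall>c\<in>A. \<forall>B\<in>sets borel. B \<subseteq> chart_domain c \<longrightarrow>
        emeasure vol B = (\<integral>\<^sup>+x\<in>coords c ` B. ennreal (sqrt (det (g c x))) \<partial>lborel))"


section \<open>The Laplace--Beltrami operator\<close>

definition partial_deriv :: "'n \<Rightarrow> (real ^ 'n \<Rightarrow> real) \<Rightarrow> real ^ 'n::finite \<Rightarrow> real" where
  "partial_deriv i f x = frechet_derivative f (at x) (axis i 1)"

definition coord_laplacian ::
  "(real ^ 'n \<Rightarrow> real ^ 'n ^ 'n) \<Rightarrow> (real ^ 'n \<Rightarrow> real) \<Rightarrow> real ^ 'n::finite \<Rightarrow> real" where
  "coord_laplacian G f x =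
     (1 / sqrt (det (G x))) *
     (\<Sum>i\<in>UNIV. partial_deriv i
        (\<lambda>y. \<Sum>j\<in>UNIV. sqrt (det (G y)) * matrix_inv (G y) $ i $ j * partial_deriv j f y) x)"

text \<open>The relation \<open>h = \<Delta>\<^sub>g f\<close>, for smooth \<open>f\<close>. By the transformation law of \<open>g\<close>, the value of
  the coordinate expression at a point is the same in all charts around it.\<close>

definition laplace_beltrami ::
  "('m, 'n::finite) chart set \<Rightarrow> ('m, 'n) metric \<Rightarrow> ('m \<Rightarrow> real) \<Rightarrow> ('m \<Rightarrow> real) \<Rightarrow> bool" where
  "laplace_beltrami A g f h \<longleftrightarrow>
     (\<forall>c\<in>A. \<forall>p\<in>chart_domain c.
        h p = coord_laplacian (g c) (\<lambda>y. f (chart_inv c y)) (coords c p))"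


section \<open>The heat kernel\<close>

text \<open>\<open>u t y\<close> is a solution of the heat equation for \<open>t > 0\<close> with initial datum the Dirac measure
  at \<open>x\<close>: the measures \<open>u t \<cdot> vol\<close> converge weakly to that measure as \<open>t\<close> tends to 0 from above.\<close>

definition dirac_heat_solution ::
  "('m::topological_space, 'n::finite) chart set \<Rightarrow> ('m, 'n) metric \<Rightarrow> 'm measure \<Rightarrow> 'm \<Rightarrow>
   (real \<Rightarrow> 'm \<Rightarrow> real) \<Rightarrow> bool" where
  "dirac_heat_solution A g vol x u \<longleftrightarrow>
     (\<forall>c\<in>A. smooth_on ({0<..} \<times> chart_range c) (\<lambda>(t, y). u t (chart_inv c y))) \<and>
     (\<forall>t>0. laplace_beltrami A g (u t) (\<lambda>y. deriv (\<lambda>s. u s y) t)) \<and>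
     (\<forall>f. continuous_on UNIV f \<longrightarrow>
        ((\<lambda>t. \<integral>y. u t y * f y \<partial>vol) \<longlongrightarrow> f x) (at_right 0))"

text \<open>\<open>p t x\<close> is the function \<open>e\<^sup>t\<^sup>\<Delta> \<delta>\<^sub>x\<close>.\<close>

definition heat_kernel ::
  "('m::topological_space, 'n::finite) chart set \<Rightarrow> ('m, 'n) metric \<Rightarrow> 'm measure \<Rightarrow>
   (real \<Rightarrow> 'm \<Rightarrow> 'm \<Rightarrow> real) \<Rightarrow> bool" where
  "heat_kernel A g vol p \<longleftrightarrow> (\<forall>x. dirac_heat_solution A g vol x (\<lambda>t y. p t x y))"

end

(*
  By Green's formula, the integral of p_s(x, z) p_r(y, z) over z depends on s + r only; letting s
  tend to 0 shows that it is p_{s+r}(y, x). The same argument with the constant solution 1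
  in place of p_r(y, .) gives that p_s(x, .) has integral 1. Hence, for U the sum of the
  p_{t/2}(x_m, .), the double sum is the integral of U^2, and Cauchy-Schwarz bounds it below by
  N^2 / vol(M).

  Green's formula: a C^1 function is split by C^1 bumps into functions supported in single charts;
  in a chart, the integral of a compactly supported derivative vanishes by translation invariance,
  and the resulting first-order integrand, the pairing of the differentials under the inverse
  metric, does not depend on the chart, so the pieces can be added up again.
*)
theory Submission
  imports Defs
begin

section \<open>Continuously differentiable functions\<close>

text \<open>\<open>heat_kernel\<close> supplies the heat equation in the space variable and weak
  convergence at time 0, for each source point separately. Symmetry and the semigroup law therefore
  have to come out of one computation, in which the Laplacian is moved from one factor to the other.

  In Green's formula only one of the two factors is cut into pieces. That factor is differentiated
  once and the other one twice, so C^1 cutoffs suffice, and squared positive parts of quadratic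
  polynomials in the coordinates can serve as bumps. \<open>laplace_beltrami\<close> and
  \<open>riemannian_volume\<close> refer to one function and one measure in all charts, so
  invariance under change of coordinates remains to be proved only for the first-order integrand.
  \<open>integral_vol_chart\<close> is the passage from the manifold to Lebesgue measure, where
  translations are available.\<close>

definition C1_on :: "'a::real_normed_vector set \<Rightarrow> ('a \<Rightarrow> 'b::real_normed_vector) \<Rightarrow> bool" where
  "C1_on S f \<longleftrightarrow> (\<forall>x\<in>S. f differentiable (at x)) \<and>
     (\<forall>v. continuous_on S (\<lambda>x. frechet_derivative f (at x) v))"

lemma Ck_on_imp_C1_on: "Ck_on (Suc 0) f S \<Longrightarrow> C1_on S f"
  by (simp add: C1_on_def)

lemma smooth_on_imp_C1_on: "smooth_on S f \<Longrightarrow> C1_on S f"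
  unfolding smooth_on_def using Ck_on_imp_C1_on by blast

lemma smooth_on_derivative:
  "smooth_on S f \<Longrightarrow> smooth_on S (\<lambda>x. frechet_derivative f (at x) v)"
  unfolding smooth_on_def using Ck_on.simps(2) by blast

lemma C1_onI:
  assumes "\<And>x. x \<in> S \<Longrightarrow> (f has_derivative f' x) (at x)"
    and "\<And>v. continuous_on S (\<lambda>x. f' x v)"
  shows "C1_on S f"
proof -
  have eq: "frechet_derivative f (at x) = f' x" if "x \<in> S" for x
    using frechet_derivative_at[OF assms(1)[OF that]] by simp
  have "continuous_on S (\<lambda>x. frechet_derivative f (at x) v)" for v
    using assms(2)[of v] by (rule continuous_on_cong[THEN iffD1, rotated 2]) (auto simp: eq)
  then show ?thesis
    unfolding C1_on_def differentiable_def using assms(1) by blast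
qed

lemma C1_on_has_derivative:
  "C1_on S f \<Longrightarrow> x \<in> S \<Longrightarrow> (f has_derivative frechet_derivative f (at x)) (at x)"
  unfolding C1_on_def using frechet_derivative_works by blast

lemma C1_on_continuous_derivative:
  "C1_on S f \<Longrightarrow> continuous_on S (\<lambda>x. frechet_derivative f (at x) v)"
  unfolding C1_on_def by blast

lemma C1_on_imp_continuous_on: "C1_on S f \<Longrightarrow> continuous_on S f"
  by (meson C1_on_def continuous_at_imp_continuous_on differentiable_imp_continuous_within)

lemma C1_on_cong:
  assumes "open S" "C1_on S f" "\<And>x. x \<in> S \<Longrightarrow> f x = h x"
  shows "C1_on S h"
  by (rule C1_onI[where f' = "\<lambda>x. frechet_derivative f (at x)"])
    (use assms C1_on_has_derivative has_derivative_transform_within_open C1_on_continuous_derivative in blast)+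

lemma C1_on_open_Un:
  assumes "open S" "open T" "C1_on S f" "C1_on T f"
  shows "C1_on (S \<union> T) f"
  using assms unfolding C1_on_def by (auto intro: continuous_on_open_Un)

lemma C1_on_const: "C1_on S (\<lambda>x. k)"
  by (rule C1_onI[where f' = "\<lambda>x v. 0"]) auto

lemma C1_on_bounded_linear_compose:
  assumes "bounded_linear L" "C1_on S f"
  shows "C1_on S (\<lambda>x. L (f x))"
proof (rule C1_onI)
  show "((\<lambda>x. L (f x)) has_derivative (\<lambda>v. L (frechet_derivative f (at x) v))) (at x)" if "x \<in> S" for x
    using bounded_linear.has_derivative[OF assms(1) C1_on_has_derivative[OF assms(2) that]] .
  show "continuous_on S (\<lambda>x. L (frechet_derivative f (at x) v))" for v
    using bounded_linear.continuous_on[OF assms(1) C1_on_continuous_derivative[OF assms(2)]] .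
qed

lemma C1_on_vec_nth: "C1_on S f \<Longrightarrow> C1_on S (\<lambda>x. f x $ i)"
  by (rule C1_on_bounded_linear_compose[OF bounded_linear_vec_nth])

lemma C1_on_add:
  assumes "C1_on S f" "C1_on S h"
  shows "C1_on S (\<lambda>x. f x + h x)"
  by (rule C1_onI[OF has_derivative_add[OF C1_on_has_derivative[OF assms(1)] C1_on_has_derivative[OF assms(2)]]])
    (auto intro!: continuous_intros C1_on_continuous_derivative assms)

lemma C1_on_mult:
  fixes f h :: "'a::real_normed_vector \<Rightarrow> real"
  assumes "C1_on S f" "C1_on S h"
  shows "C1_on S (\<lambda>x. f x * h x)"
  by (rule C1_onI[OF has_derivative_mult[OF C1_on_has_derivative[OF assms(1)] C1_on_has_derivative[OF assms(2)]]])
    (auto intro!: continuous_intros C1_on_continuous_derivative assms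
       C1_on_imp_continuous_on[OF assms(1)] C1_on_imp_continuous_on[OF assms(2)])

lemma C1_on_sum: "(\<And>i. i \<in> I \<Longrightarrow> C1_on S (f i)) \<Longrightarrow> C1_on S (\<lambda>x. \<Sum>i\<in>I. f i x)"
  by (induction I rule: infinite_finite_induct) (auto intro: C1_on_const C1_on_add)

lemma C1_on_prod:
  fixes f :: "'i \<Rightarrow> 'a::real_normed_vector \<Rightarrow> real"
  shows "(\<And>i. i \<in> I \<Longrightarrow> C1_on S (f i)) \<Longrightarrow> C1_on S (\<lambda>x. \<Prod>i\<in>I. f i x)"
  by (induction I rule: infinite_finite_induct) (auto intro: C1_on_const C1_on_mult)

lemma C1_on_real_compose:
  fixes f :: "'a::real_normed_vector \<Rightarrow> real" and \<phi> :: "real \<Rightarrow> real"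
  assumes f: "C1_on S f"
    and d: "\<And>x. x \<in> S \<Longrightarrow> (\<phi> has_real_derivative \<phi>' (f x)) (at (f x))"
    and c: "continuous_on S (\<lambda>x. \<phi>' (f x))"
  shows "C1_on S (\<lambda>x. \<phi> (f x))"
proof (rule C1_onI)
  show "((\<lambda>x. \<phi> (f x)) has_derivative (\<lambda>v. \<phi>' (f x) * frechet_derivative f (at x) v)) (at x)"
    if "x \<in> S" for x
    using has_derivative_compose[OF C1_on_has_derivative[OF f that] d[OF that, unfolded has_field_derivative_def]]
    by simp
  show "continuous_on S (\<lambda>x. \<phi>' (f x) * frechet_derivative f (at x) v)" for v
    by (intro continuous_intros c C1_on_continuous_derivative f)
qed

lemma C1_on_inverse:
  fixes f :: "'a::real_normed_vector \<Rightarrow> real"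
  assumes "C1_on S f" "\<And>x. x \<in> S \<Longrightarrow> f x \<noteq> 0"
  shows "C1_on S (\<lambda>x. inverse (f x))"
proof (rule C1_on_real_compose[OF assms(1), where \<phi>' = "\<lambda>s. - (inverse s ^ Suc (Suc 0))"])
  show "(inverse has_real_derivative - (inverse (f x) ^ Suc (Suc 0))) (at (f x))" if "x \<in> S" for x
    by (rule DERIV_inverse) (use assms(2) that in auto)
  show "continuous_on S (\<lambda>x. - (inverse (f x) ^ Suc (Suc 0)))"
    by (intro continuous_intros C1_on_imp_continuous_on assms) (use assms(2) in auto)
qed

lemma C1_on_divide:
  fixes f h :: "'a::real_normed_vector \<Rightarrow> real"
  assumes "C1_on S f" "C1_on S h" "\<And>x. x \<in> S \<Longrightarrow> h x \<noteq> 0"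
  shows "C1_on S (\<lambda>x. f x / h x)"
  unfolding divide_inverse by (intro C1_on_mult C1_on_inverse assms)

lemma C1_on_sqrt:
  fixes f :: "'a::real_normed_vector \<Rightarrow> real"
  assumes "C1_on S f" "\<And>x. x \<in> S \<Longrightarrow> f x > 0"
  shows "C1_on S (\<lambda>x. sqrt (f x))"
proof (rule C1_on_real_compose[OF assms(1), where \<phi>' = "\<lambda>s. inverse (sqrt s) / 2"])
  show "(sqrt has_real_derivative inverse (sqrt (f x)) / 2) (at (f x))" if "x \<in> S" for x
    by (rule DERIV_real_sqrt) (use assms(2) that in auto)
  show "continuous_on S (\<lambda>x. inverse (sqrt (f x)) / 2)"
    by (intro continuous_intros C1_on_imp_continuous_on assms) (use assms(2) in force)+
qed

text \<open>Squaring removes the corner of the positive part at 0: the difference quotient there is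
  bounded by \<open>\<bar>h\<bar>\<close>, and the derivative is continuous. This makes the bumps
  C^1 across the boundary of their support.\<close>

lemma has_real_derivative_max_0_squared:
  "((\<lambda>s::real. (max 0 s)\<^sup>2) has_real_derivative 2 * max 0 s) (at s)"
proof (cases "s = 0")
  case True
  have "(\<lambda>h::real. (max 0 h)\<^sup>2 / h) \<midarrow>0\<rightarrow> 0"
  proof (rule Lim_null_comparison[where g = "\<lambda>h. \<bar>h\<bar>"])
    show "\<forall>\<^sub>F h in at (0::real). norm ((max 0 h)\<^sup>2 / h) \<le> \<bar>h\<bar>"
      by (intro always_eventually allI) (auto simp: max_def power2_eq_square)
    show "(\<lambda>h::real. \<bar>h\<bar>) \<midarrow>0\<rightarrow> 0"
      by (rule tendsto_eq_intros | simp)+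
  qed
  then show ?thesis using True by (simp add: DERIV_def)
next
  case False
  show ?thesis
  proof (cases "s > 0")
    case True
    have "((\<lambda>s::real. s\<^sup>2) has_real_derivative 2 * max 0 s) (at s)"
      using True by (auto intro!: derivative_eq_intros)
    then show ?thesis
      by (rule has_field_derivative_transform_within_open[where S = "{0<..}"]) (use True in auto)
  next
    case neg: False
    have "((\<lambda>s::real. 0) has_real_derivative 2 * max 0 s) (at s)"
      using neg by auto
    then show ?thesis
      by (rule has_field_derivative_transform_within_open[where S = "{..<0}"]) (use neg False in auto)
  qed
qed

lemma C1_on_bump:
  fixes T :: "'a::real_normed_vector \<Rightarrow> real ^ 'n::finite"
  assumes "C1_on S T"
  shows "C1_on S (\<lambda>y. (max 0 (r\<^sup>2 - (T y - a) \<bullet> (T y - a)))\<^sup>2)"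
proof -
  have "C1_on S (\<lambda>y. r\<^sup>2 + (- 1) * (\<Sum>i\<in>UNIV. (T y $ i + - a $ i) * (T y $ i + - a $ i)))"
    by (intro C1_on_add C1_on_mult C1_on_const C1_on_sum C1_on_vec_nth assms)
  then have q: "C1_on S (\<lambda>y. r\<^sup>2 - (T y - a) \<bullet> (T y - a))"
    by (simp add: inner_vec_def)
  show ?thesis
    by (rule C1_on_real_compose[OF q has_real_derivative_max_0_squared])
      (intro continuous_intros C1_on_imp_continuous_on[OF q])
qed

section \<open>Determinants and inverse matrices depending on a point\<close>

lemma C1_on_det:
  fixes M :: "'a::real_normed_vector \<Rightarrow> real ^ 'n ^ 'n"
  assumes "\<And>i j. C1_on S (\<lambda>x. M x $ i $ j)"
  shows "C1_on S (\<lambda>x. det (M x))"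
  unfolding det_def by (intro C1_on_sum C1_on_mult C1_on_prod C1_on_const assms)

text \<open>Cramer's rule applied to the columns of the identity. It shows each entry of the inverse
  as a quotient of polynomials in the entries of \<open>M\<close>, from which C^1 dependence
  follows.\<close>

lemma matrix_inv_cramer:
  fixes M :: "real ^ 'n ^ 'n"
  assumes "det M \<noteq> 0"
  shows "matrix_inv M $ i $ j = det (\<chi> r s. if s = i then axis j 1 $ r else M $ r $ s) / det M"
proof -
  have "invertible M" using assms by (simp add: invertible_det_nz)
  then have "M ** matrix_inv M = mat 1"
    unfolding invertible_def matrix_inv_def by (rule someI2_ex) simp
  then have "M *v (matrix_inv M *v axis j 1) = axis j 1"
    by (simp add: matrix_vector_mul_assoc)
  then have "matrix_inv M *v axis j 1 =
      (\<chi> k. det (\<chi> r s. if s = k then axis j 1 $ r else M $ r $ s) / det M)"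
    using cramer[OF assms] by blast
  then show ?thesis
    by (simp add: matrix_vector_mult_basis column_def vec_eq_iff)
qed

lemma C1_on_matrix_inv:
  fixes M :: "'a::real_normed_vector \<Rightarrow> real ^ 'n ^ 'n"
  assumes "open S" and C: "\<And>i j. C1_on S (\<lambda>x. M x $ i $ j)" and nz: "\<And>x. x \<in> S \<Longrightarrow> det (M x) \<noteq> 0"
  shows "C1_on S (\<lambda>x. matrix_inv (M x) $ i $ j)"
proof (rule C1_on_cong[OF assms(1)])
  show "C1_on S (\<lambda>x. det (\<chi> r s. if s = i then axis j 1 $ r else M x $ r $ s) / det (M x))"
  proof (intro C1_on_divide C1_on_det C nz)
    show "C1_on S (\<lambda>x. (\<chi> r s. if s = i then axis j 1 $ r else M x $ r $ s) $ k $ l)" for k l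
      by (cases "l = i") (auto intro: C C1_on_const)
  qed
qed (simp add: matrix_inv_cramer nz)

text \<open>Every matrix on the segment from the identity to \<open>M\<close> is positive definite
  as well, hence has trivial kernel. So the determinant has no zero on the segment and keeps the
  sign it has at the identity.\<close>

lemma det_pos_if_positive_definite:
  fixes M :: "real ^ 'n ^ 'n"
  assumes pos: "\<And>v. v \<noteq> 0 \<Longrightarrow> v \<bullet> (M *v v) > 0"
  shows "det M > 0"
proof (rule ccontr)
  assume neg: "\<not> det M > 0"
  define P where "P s = (1 - s) *\<^sub>R mat 1 + s *\<^sub>R M" for s :: real
  have Pv: "P s *v v = (1 - s) *\<^sub>R v + s *\<^sub>R (M *v v)" for s v
    unfolding P_def by (simp add: matrix_vector_mult_add_rdistrib scaleR_matrix_vector_assoc[symmetric])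
  have nz: "det (P s) \<noteq> 0" if s: "0 \<le> s" "s \<le> 1" for s
  proof -
    have "v = 0" if "P s *v v = 0" for v
    proof (rule ccontr)
      assume "v \<noteq> 0"
      have "v \<bullet> v > 0" "v \<bullet> (M *v v) > 0" using pos \<open>v \<noteq> 0\<close> by auto
      moreover have "v \<bullet> (P s *v v) = (1 - s) * (v \<bullet> v) + s * (v \<bullet> (M *v v))"
        by (simp add: Pv inner_add_right)
      ultimately have "v \<bullet> (P s *v v) > 0"
        using s by (cases "s = 0") (auto intro!: add_nonneg_pos)
      then show False using that by simp
    qed
    then show ?thesis
      by (metis invertible_det_nz invertible_left_inverse matrix_left_invertible_ker)
  qed
  have "continuous_on {0..1} (\<lambda>s. det (P s))"
    unfolding P_def det_def by (auto intro!: continuous_intros)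
  moreover have "det (P 0) = 1" "det (P 1) = det M" by (simp_all add: P_def)
  ultimately have "\<exists>s\<ge>0. s \<le> 1 \<and> det (P s) = 0"
    using neg by (intro IVT2') auto
  then show False using nz by blast
qed

section \<open>Differentiation under the integral\<close>

text \<open>The mean value inequality bounds all difference quotients by \<open>w\<close>, so
  dominated convergence applies along any sequence tending to \<open>t\<close>.\<close>

lemma has_real_derivative_integral:
  fixes f :: "real \<Rightarrow> 'a \<Rightarrow> real"
  assumes e: "e > 0"
    and int: "\<And>s. s \<in> ball t e \<Longrightarrow> integrable M (f s)"
    and der: "\<And>s z. s \<in> ball t e \<Longrightarrow> z \<in> space M \<Longrightarrow> ((\<lambda>s. f s z) has_real_derivative f' s z) (at s)"
    and bound: "\<And>s z. s \<in> ball t e \<Longrightarrow> z \<in> space M \<Longrightarrow> \<bar>f' s z\<bar> \<le> w z"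
    and w: "integrable M w"
    and meas: "f' t \<in> borel_measurable M"
  shows "((\<lambda>s. \<integral>z. f s z \<partial>M) has_real_derivative (\<integral>z. f' t z \<partial>M)) (at t)"
  unfolding has_field_derivative_iff tendsto_at_iff_sequentially comp_def
proof (intro allI impI)
  fix X :: "nat \<Rightarrow> real"
  assume X: "\<forall>i. X i \<in> UNIV - {t}" and lim: "X \<longlonglongrightarrow> t"
  have t: "t \<in> ball t e" using e by simp
  \<comment> \<open>Only a tail of the sequence is known to lie in the ball where the bound holds;
    the shift by \<open>k\<close> is undone at the end.\<close>
  obtain k where k: "\<And>i. X (i + k) \<in> ball t e"
    using topological_tendstoD[OF lim open_ball t] unfolding eventually_sequentially
    by (metis le_add2)
  define q where "q i z = (f (X (i + k)) z - f t z) / (X (i + k) - t)" for i z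
  have "(\<lambda>i. \<integral>z. q i z \<partial>M) \<longlonglongrightarrow> (\<integral>z. f' t z \<partial>M)"
  proof (rule integral_dominated_convergence[where w = w])
    show "AE z in M. (\<lambda>i. q i z) \<longlonglongrightarrow> f' t z"
    proof (rule AE_I2)
      fix z assume "z \<in> space M"
      then have "((\<lambda>s. (f s z - f t z) / (s - t)) \<longlongrightarrow> f' t z) (at t)"
        using der[OF t] by (simp add: has_field_derivative_iff)
      moreover have "(\<lambda>i. X (i + k)) \<longlonglongrightarrow> t" "\<And>i. X (i + k) \<noteq> t"
        using LIMSEQ_ignore_initial_segment[OF lim] X by auto
      ultimately show "(\<lambda>i. q i z) \<longlonglongrightarrow> f' t z"
        unfolding tendsto_at_iff_sequentially q_def comp_def by auto
    qed
    show "AE z in M. norm (q i z) \<le> w z" for i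
    proof (rule AE_I2)
      fix z assume z: "z \<in> space M"
      have "norm (f (X (i + k)) z - f t z) \<le> w z * norm (X (i + k) - t)"
        by (rule field_differentiable_bound[where S = "ball t e" and f' = "\<lambda>s. f' s z"])
          (use der z bound k t in \<open>auto intro: has_field_derivative_at_within\<close>)
      then show "norm (q i z) \<le> w z"
        using X by (simp add: q_def norm_divide pos_divide_le_eq)
    qed
    show "q i \<in> borel_measurable M" for i
      unfolding q_def using int[OF k[of i]] int[OF t] by measurable
  qed (use w meas in auto)
  also have "(\<lambda>i. \<integral>z. q i z \<partial>M) = (\<lambda>i. ((\<integral>z. f (X (i + k)) z \<partial>M) - (\<integral>z. f t z \<partial>M)) / (X (i + k) - t))"
    unfolding q_def by (simp add: Bochner_Integration.integral_diff[OF int[OF k] int[OF t]])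
  finally show "(\<lambda>i. ((\<integral>z. f (X i) z \<partial>M) - (\<integral>z. f t z \<partial>M)) / (X i - t)) \<longlonglongrightarrow> (\<integral>z. f' t z \<partial>M)"
    by (rule LIMSEQ_offset)
qed

section \<open>Compactly supported functions on Euclidean space\<close>

lemma integrable_continuous_compact_support:
  fixes f :: "'a::euclidean_space \<Rightarrow> real"
  assumes "continuous_on K f" "compact K" "\<And>x. x \<notin> K \<Longrightarrow> f x = 0"
  shows "integrable lborel f"
proof -
  have "(\<lambda>x. indicator K x *\<^sub>R f x) = f"
    by (rule ext) (use assms(3) in \<open>auto simp: indicator_def\<close>)
  then show ?thesis using borel_integrable_compact[OF assms(2,1)] by simp
qed

text \<open>The open sets \<open>S\<close> and \<open>- K\<close> cover the space, and
  \<open>F\<close> vanishes on the second.\<close>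

lemma C1_on_UNIV_extend_zero:
  assumes "open S" "C1_on S F" "closed K" "K \<subseteq> S" "\<And>y. y \<notin> K \<Longrightarrow> F y = 0"
  shows "C1_on UNIV F"
proof -
  have "C1_on (- K) F"
    by (rule C1_on_cong[where f = "\<lambda>y. 0"]) (use assms in \<open>auto intro: C1_on_const\<close>)
  then have "C1_on (S \<union> - K) F" using assms by (intro C1_on_open_Un) auto
  moreover have "S \<union> - K = UNIV" using assms(4) by auto
  ultimately show ?thesis by simp
qed

lemma frechet_derivative_zero_outside:
  assumes "closed K" "\<And>y. y \<notin> K \<Longrightarrow> F y = 0" "y \<notin> K"
  shows "frechet_derivative F (at y) = (\<lambda>v. 0)"
proof -
  have "(F has_derivative (\<lambda>v. 0)) (at y)"
    by (rule has_derivative_transform_within_open[where f = "\<lambda>y. 0" and s = "- K"]) (use assms in auto)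
  then show ?thesis by (rule frechet_derivative_at[symmetric])
qed

text \<open>By translation invariance of Lebesgue measure, the integral of \<open>F (y + s v)\<close> does not
  depend on \<open>s\<close>.\<close>

lemma integral_directional_derivative_eq_0:
  fixes F :: "'a::euclidean_space \<Rightarrow> real"
  assumes C: "C1_on UNIV F" and K: "compact K" and zero: "\<And>y. y \<notin> K \<Longrightarrow> F y = 0"
  shows "(\<integral>y. frechet_derivative F (at y) v \<partial>lborel) = 0"
proof -
  define D where "D y = frechet_derivative F (at y) v" for y
  have contD: "continuous_on S D" for S
    unfolding D_def using C1_on_continuous_derivative[OF C] continuous_on_subset by blast
  have contF: "continuous_on S F" for S
    using C1_on_imp_continuous_on[OF C] continuous_on_subset by blast
  have zeroD: "D y = 0" if "y \<notin> K" for y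
    unfolding D_def using frechet_derivative_zero_outside[OF compact_imp_closed[OF K] zero that] by simp
  obtain B where B: "\<And>y. y \<in> K \<Longrightarrow> \<bar>D y\<bar> \<le> B"
    using compact_imp_bounded[OF compact_continuous_image[OF contD K]] unfolding bounded_iff by auto
  obtain R where R: "\<And>y. y \<in> K \<Longrightarrow> norm y \<le> R"
    using compact_imp_bounded[OF K] unfolding bounded_iff by auto
  have bound: "\<bar>D y\<bar> \<le> \<bar>B\<bar> * indicator K y" for y
    using B[of y] zeroD[of y] by (auto simp: indicator_def)
  \<comment> \<open>For shifts with \<open>\<bar>s\<bar> < 1\<close> the support of the translated
    function stays in this fixed ball, so the dominating function can be chosen independently of
    \<open>s\<close>.\<close>
  define K' :: "'a set" where "K' = cball 0 (R + norm v)"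
  have K': "y \<in> K'" if "y + s *\<^sub>R v \<in> K" "s \<in> ball 0 1" for y s
  proof -
    have "norm y \<le> norm (y + s *\<^sub>R v) + norm (s *\<^sub>R v)"
      by (metis add_diff_cancel norm_triangle_ineq4)
    also have "norm (s *\<^sub>R v) \<le> norm v" using that(2) by (simp add: mult_left_le_one_le)
    finally show ?thesis using R[OF that(1)] by (simp add: K'_def)
  qed
  have "((\<lambda>s. \<integral>y. F (y + s *\<^sub>R v) \<partial>lborel) has_real_derivative (\<integral>y. D (y + 0 *\<^sub>R v) \<partial>lborel)) (at 0)"
  proof (rule has_real_derivative_integral[where e = 1 and w = "\<lambda>y. \<bar>B\<bar> * indicator K' y"])
    show "integrable lborel (\<lambda>y. F (y + s *\<^sub>R v))" if s: "s \<in> ball 0 1" for s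
    proof (rule integrable_continuous_compact_support)
      show "continuous_on K' (\<lambda>y. F (y + s *\<^sub>R v))"
        by (rule continuous_on_compose2[OF contF[of UNIV]]) (auto intro!: continuous_intros)
      show "F (y + s *\<^sub>R v) = 0" if "y \<notin> K'" for y
        using K'[OF _ s] that zero by blast
    qed (simp add: K'_def)
    show "((\<lambda>s. F (y + s *\<^sub>R v)) has_real_derivative D (y + s *\<^sub>R v)) (at s)" for s y
    proof -
      have *: "((\<lambda>s. y + s *\<^sub>R v) has_derivative (\<lambda>h. h *\<^sub>R v)) (at s)"
        by (auto intro!: derivative_eq_intros)
      have F: "(F has_derivative frechet_derivative F (at (y + s *\<^sub>R v))) (at (y + s *\<^sub>R v))"
        using C1_on_has_derivative[OF C] by simp
      have "((\<lambda>s. F (y + s *\<^sub>R v)) has_derivative (\<lambda>h. frechet_derivative F (at (y + s *\<^sub>R v)) (h *\<^sub>R v))) (at s)"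
        using has_derivative_compose[OF * F] .
      moreover have "frechet_derivative F (at (y + s *\<^sub>R v)) (h *\<^sub>R v) = D (y + s *\<^sub>R v) * h" for h
        unfolding D_def using linear_scale[OF has_derivative_linear[OF F]] by simp
      ultimately show ?thesis by (simp add: has_field_derivative_def)
    qed
    show "\<bar>D (y + s *\<^sub>R v)\<bar> \<le> \<bar>B\<bar> * indicator K' y" if "s \<in> ball 0 1" for s y
      by (rule order_trans[OF bound]) (use K'[OF _ that] in \<open>auto simp: indicator_def\<close>)
    show "integrable lborel (\<lambda>y. \<bar>B\<bar> * indicator K' y)"
      by (intro integrable_mult_right integrable_real_indicator)
        (auto simp: K'_def emeasure_bounded_finite[unfolded infinity_ennreal_def])
    show "(\<lambda>y. D (y + 0 *\<^sub>R v)) \<in> borel_measurable lborel"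
      using borel_measurable_continuous_onI[OF contD] by simp
  qed simp
  moreover have "(\<integral>y. F (y + s *\<^sub>R v) \<partial>lborel) = (\<integral>y. F y \<partial>lborel)" for s
  proof -
    have "(\<integral>y. F y \<partial>distr lborel borel ((+) (s *\<^sub>R v))) = (\<integral>y. F (s *\<^sub>R v + y) \<partial>lborel)"
      by (rule integral_distr) (use borel_measurable_continuous_onI[OF contF] in auto)
    then show ?thesis by (simp add: lborel_distr_plus add.commute)
  qed
  ultimately have "((\<lambda>s::real. \<integral>y. F y \<partial>lborel) has_real_derivative (\<integral>y. D y \<partial>lborel)) (at 0)"
    by simp
  then show ?thesis
    unfolding D_def by (metis DERIV_const DERIV_unique)
qed

section \<open>Charts, bump functions and the volume measure\<close>

locale closed_riemannian =
  fixes A :: "('m::t2_space, 'n::finite) chart set"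
    and g :: "('m, 'n) metric"
    and vol :: "'m measure"
  assumes manifold: "compact_smooth_manifold A"
    and metric: "riemannian_metric A g"
    and volume: "riemannian_volume A g vol"
begin

section \<open>Charts and functions on the manifold\<close>

lemma chartD:
  assumes "c \<in> A"
  shows "open (chart_domain c)" "open (chart_range c)"
    "continuous_on (chart_domain c) (coords c)" "continuous_on (chart_range c) (chart_inv c)"
    "\<And>z. z \<in> chart_domain c \<Longrightarrow> coords c z \<in> chart_range c"
    "\<And>y. y \<in> chart_range c \<Longrightarrow> chart_inv c y \<in> chart_domain c"
    "\<And>z. z \<in> chart_domain c \<Longrightarrow> chart_inv c (coords c z) = z"
    "\<And>y. y \<in> chart_range c \<Longrightarrow> coords c (chart_inv c y) = y"
proof -
  have "is_chart c"
    using manifold assms unfolding compact_smooth_manifold_def smooth_atlas_def by blast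
  then show "open (chart_domain c)" "open (chart_range c)"
    "continuous_on (chart_domain c) (coords c)" "continuous_on (chart_range c) (chart_inv c)"
    "\<And>z. z \<in> chart_domain c \<Longrightarrow> coords c z \<in> chart_range c"
    "\<And>y. y \<in> chart_range c \<Longrightarrow> chart_inv c y \<in> chart_domain c"
    "\<And>z. z \<in> chart_domain c \<Longrightarrow> chart_inv c (coords c z) = z"
    "\<And>y. y \<in> chart_range c \<Longrightarrow> coords c (chart_inv c y) = y"
    unfolding is_chart_def homeomorphism_def by auto
qed

lemma compact_UNIV: "compact (UNIV :: 'm set)"
  using manifold unfolding compact_smooth_manifold_def by blast

lemma chart_at: obtains c where "c \<in> A" "p \<in> chart_domain c"
proof -
  have "p \<in> (\<Union>c\<in>A. chart_domain c)"
    using manifold unfolding compact_smooth_manifold_def smooth_atlas_def by blast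
  then show ?thesis using that by blast
qed

lemma Un_chart_domain: "(\<Union>c\<in>A. chart_domain c) = UNIV"
  using manifold unfolding compact_smooth_manifold_def smooth_atlas_def by blast

lemma C1_on_transition:
  "c \<in> A \<Longrightarrow> d \<in> A \<Longrightarrow> C1_on (coords c ` (chart_domain c \<inter> chart_domain d)) (transition c d)"
  using manifold unfolding compact_smooth_manifold_def smooth_atlas_def
  by (blast intro: smooth_on_imp_C1_on)

lemma coords_image:
  "c \<in> A \<Longrightarrow> coords c ` (chart_domain c \<inter> B) = {y \<in> chart_range c. chart_inv c y \<in> B}"
  using chartD(5-8)[of c] by (force simp: image_iff)

lemma open_coords_image:
  assumes "c \<in> A" "open B"
  shows "open (coords c ` (chart_domain c \<inter> B))"
proof -
  have "{y \<in> chart_range c. chart_inv c y \<in> B} = chart_range c \<inter> chart_inv c -` B" by auto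
  then show ?thesis
    using continuous_open_preimage[OF chartD(4,2)[OF assms(1)] assms(2)]
    by (simp add: coords_image[OF assms(1)])
qed

lemma continuous_on_UNIV_local:
  fixes f :: "'m \<Rightarrow> 'b::topological_space"
  assumes "\<And>c. c \<in> A \<Longrightarrow> continuous_on (chart_range c) (\<lambda>y. f (chart_inv c y))"
  shows "continuous_on UNIV f"
proof -
  have "continuous_on (chart_domain c) f" if c: "c \<in> A" for c
  proof -
    have "continuous_on (chart_domain c) (\<lambda>z. f (chart_inv c (coords c z)))"
      by (rule continuous_on_compose2[OF assms[OF c] chartD(3)[OF c]]) (use chartD(5)[OF c] in auto)
    then show ?thesis
      by (rule continuous_on_cong[THEN iffD1, rotated 2]) (auto simp: chartD(7)[OF c])
  qed
  then have "continuous_on (\<Union>c\<in>A. chart_domain c) f"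
    by (intro continuous_on_open_UN chartD)
  then show ?thesis by (simp add: Un_chart_domain)
qed

definition C1_manifold :: "('m \<Rightarrow> real) \<Rightarrow> bool" where
  "C1_manifold f \<longleftrightarrow> (\<forall>c\<in>A. C1_on (chart_range c) (\<lambda>y. f (chart_inv c y)))"

lemma C1_manifold_imp_continuous: "C1_manifold f \<Longrightarrow> continuous_on UNIV f"
  unfolding C1_manifold_def using C1_on_imp_continuous_on continuous_on_UNIV_local by blast

section \<open>Bumps and a partition of unity\<close>

lemma chart_cball:
  obtains c r where "c \<in> A" "p \<in> chart_domain c" "r > 0" "cball (coords c p) r \<subseteq> chart_range c"
proof -
  obtain c where c: "c \<in> A" "p \<in> chart_domain c" by (rule chart_at)
  then show ?thesis
    using open_contains_cball[of "chart_range c"] chartD(2,5)[of c] that by metis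
qed

text \<open>The value 0 off the chart domain extends the function to the whole manifold. The
  extension is C^1 once the closed ball of radius \<open>r\<close> around \<open>a\<close> lies in
  the chart range.\<close>

definition bump :: "('m, 'n) chart \<Rightarrow> real ^ 'n \<Rightarrow> real \<Rightarrow> 'm \<Rightarrow> real" where
  "bump c a r z = (if z \<in> chart_domain c
     then (max 0 (r\<^sup>2 - (coords c z - a) \<bullet> (coords c z - a)))\<^sup>2 else 0)"

lemma bump_nonneg: "bump c a r z \<ge> 0"
  unfolding bump_def by simp

lemma bump_pos_iff:
  assumes "r > 0"
  shows "bump c a r z > 0 \<longleftrightarrow> z \<in> chart_domain c \<and> coords c z \<in> ball a r"
proof -
  have "(coords c z - a) \<bullet> (coords c z - a) < r\<^sup>2 \<longleftrightarrow> dist a (coords c z) < r"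
    using assms power_strict_mono[of "norm (coords c z - a)" r 2]
      power2_less_imp_less[of "norm (coords c z - a)" r]
    by (auto simp: dist_norm norm_minus_commute power2_norm_eq_inner[symmetric])
  then show ?thesis unfolding bump_def by (auto simp: max_def)
qed

text \<open>The range of another chart \<open>d\<close> is covered by two open sets: on the overlap
  with \<open>c\<close> the bump is a C^1 function of the transition map, and off the image
  \<open>?Q\<close> of the closed ball it is zero. The second set is open because the compact set
  \<open>?Q\<close> is closed in a Hausdorff space.\<close>

lemma C1_manifold_bump:
  assumes c: "c \<in> A" and r: "r > 0" and sub: "cball a r \<subseteq> chart_range c"
  shows "C1_manifold (bump c a r)"
  unfolding C1_manifold_def
proof
  fix d assume d: "d \<in> A"
  let ?S = "coords d ` (chart_domain d \<inter> chart_domain c)"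
  let ?Q = "chart_inv c ` cball a r"
  let ?S' = "coords d ` (chart_domain d \<inter> - ?Q)"
  have "compact ?Q"
    by (rule compact_continuous_image[OF continuous_on_subset[OF chartD(4)[OF c] sub]]) simp
  then have op: "open ?S" "open ?S'"
    using chartD(1)[OF c] by (auto intro!: open_coords_image d compact_imp_closed)
  have "C1_on ?S (\<lambda>y. bump c a r (chart_inv d y))"
  proof (rule C1_on_cong[OF op(1) C1_on_bump[OF C1_on_transition[OF d c]]])
    show "(max 0 (r\<^sup>2 - (transition d c y - a) \<bullet> (transition d c y - a)))\<^sup>2 = bump c a r (chart_inv d y)"
      if "y \<in> ?S" for y
      using that by (auto simp: bump_def transition_def chartD(7)[OF d])
  qed
  moreover have "C1_on ?S' (\<lambda>y. bump c a r (chart_inv d y))"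
  proof (rule C1_on_cong[OF op(2) C1_on_const])
    fix y assume "y \<in> ?S'"
    then have "chart_inv d y \<notin> ?Q" unfolding coords_image[OF d] by blast
    then have "\<not> bump c a r (chart_inv d y) > 0"
      unfolding bump_pos_iff[OF r] using chartD(7)[OF c]
      by (metis ball_subset_cball image_eqI subsetD)
    then show "0 = bump c a r (chart_inv d y)" using bump_nonneg[of c a r "chart_inv d y"] by linarith
  qed
  moreover have "?S \<union> ?S' = chart_range d"
    unfolding coords_image[OF d] using chartD(6)[OF c] sub by auto
  ultimately show "C1_on (chart_range d) (\<lambda>y. bump c a r (chart_inv d y))"
    using C1_on_open_Un[OF op] by metis
qed

lemma finite_chart_balls:
  "\<exists>(P :: 'm set) c r. finite P \<and>
    (\<forall>p\<in>P. c p \<in> A \<and> r p > 0 \<and> cball (coords (c p) p) (r p) \<subseteq> chart_range (c p)) \<and>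
    (\<forall>z. \<exists>p\<in>P. z \<in> chart_domain (c p) \<and> coords (c p) z \<in> ball (coords (c p) p) (r p))"
proof -
  have "\<exists>c r. c \<in> A \<and> p \<in> chart_domain c \<and> r > 0 \<and> cball (coords c p) r \<subseteq> chart_range c" for p
    by (rule chart_cball[of p]) blast
  then obtain c r where cr: "\<And>p. c p \<in> A" "\<And>p. p \<in> chart_domain (c p)" "\<And>p. r p > 0"
    "\<And>p. cball (coords (c p) p) (r p) \<subseteq> chart_range (c p)" by metis
  define U where "U p = chart_domain (c p) \<inter> coords (c p) -` ball (coords (c p) p) (r p)" for p
  have "open (U p)" for p
    unfolding U_def by (intro continuous_open_preimage chartD cr open_ball)
  moreover have "UNIV \<subseteq> (\<Union>p\<in>UNIV. U p)"
    using cr(2,3) unfolding U_def by force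
  ultimately obtain P where "finite P" "UNIV \<subseteq> (\<Union>p\<in>P. U p)"
    using compactE_image[OF compact_UNIV] by metis
  moreover have "\<exists>p\<in>P. z \<in> chart_domain (c p) \<and> coords (c p) z \<in> ball (coords (c p) p) (r p)" for z
    using \<open>UNIV \<subseteq> (\<Union>p\<in>P. U p)\<close> unfolding U_def by blast
  ultimately show ?thesis
    using cr by (intro exI[of _ P] exI[of _ c] exI[of _ r]) blast
qed

text \<open>The balls of \<open>finite_chart_balls\<close> cover the manifold, so the sum of their
  bumps is positive, and each bump divided by this sum is a member of a partition of unity. The
  supports are recorded as compact sets of coordinates, since integration by parts happens
  there.\<close>

lemma C1_manifold_decomposition:
  assumes u: "C1_manifold u"
  shows "\<exists>(P :: 'm set) c K w. finite P \<and>
    (\<forall>p\<in>P. c p \<in> A \<and> compact (K p) \<and> K p \<subseteq> chart_range (c p) \<and> C1_manifold (w p) \<and>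
      (\<forall>z. z \<notin> chart_inv (c p) ` K p \<longrightarrow> w p z = 0)) \<and>
    (\<forall>z. u z = (\<Sum>p\<in>P. w p z))"
proof -
  obtain P :: "'m set" and c r where P: "finite P"
    "\<And>p. p \<in> P \<Longrightarrow> c p \<in> A" "\<And>p. p \<in> P \<Longrightarrow> r p > (0::real)"
    "\<And>p. p \<in> P \<Longrightarrow> cball (coords (c p) p) (r p) \<subseteq> chart_range (c p)"
    "\<And>z. \<exists>p\<in>P. z \<in> chart_domain (c p) \<and> coords (c p) z \<in> ball (coords (c p) p) (r p)"
    using finite_chart_balls by metis
  define b where "b p = bump (c p) (coords (c p) p) (r p)" for p
  define s where "s z = (\<Sum>p\<in>P. b p z)" for z
  have s: "s z > 0" for z
  proof -
    obtain p where "p \<in> P" "b p z > 0"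
      using P(5)[of z] bump_pos_iff[OF P(3)] unfolding b_def by blast
    then show ?thesis
      unfolding s_def by (intro sum_pos2[OF P(1)]) (auto simp: b_def bump_nonneg)
  qed
  have Cb: "C1_manifold (b p)" if "p \<in> P" for p
    unfolding b_def by (intro C1_manifold_bump P that)
  show ?thesis
  proof (rule exI[of _ P], rule exI[of _ c], rule exI[of _ "\<lambda>p. cball (coords (c p) p) (r p)"],
      rule exI[of _ "\<lambda>p z. b p z * u z / s z"], intro conjI ballI allI impI)
    show "C1_manifold (\<lambda>z. b p z * u z / s z)" if "p \<in> P" for p
      unfolding C1_manifold_def
    proof
      fix d assume d: "d \<in> A"
      show "C1_on (chart_range d) (\<lambda>y. b p (chart_inv d y) * u (chart_inv d y) / s (chart_inv d y))"
      proof (intro C1_on_divide C1_on_mult)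
        show "C1_on (chart_range d) (\<lambda>y. s (chart_inv d y))"
          unfolding s_def by (intro C1_on_sum) (use Cb d in \<open>auto simp: C1_manifold_def\<close>)
      qed (use u Cb[OF that] d s in \<open>auto simp: C1_manifold_def less_imp_neq[symmetric]\<close>)
    qed
    show "b p z * u z / s z = 0" if "p \<in> P" "z \<notin> chart_inv (c p) ` cball (coords (c p) p) (r p)" for p z
    proof -
      have "\<not> b p z > 0"
        unfolding b_def bump_pos_iff[OF P(3)[OF that(1)]] using chartD(7)[OF P(2)[OF that(1)]] that(2)
        by (metis ball_subset_cball image_eqI subsetD)
      then have "b p z = 0" using bump_nonneg[of "c p" "coords (c p) p" "r p" z] unfolding b_def by linarith
      then show ?thesis by simp
    qed
    show "u z = (\<Sum>p\<in>P. b p z * u z / s z)" for z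
      using s[of z] by (simp add: s_def flip: sum_divide_distrib sum_distrib_right)
  qed (use P in auto)
qed

section \<open>The metric and its inverse in coordinates\<close>

lemma C1_on_metric:
  assumes "c \<in> A"
  shows "C1_on (chart_range c) (\<lambda>y. g c y $ i $ j)"
proof -
  have "smooth_on (chart_range c) (g c)"
    using metric assms unfolding riemannian_metric_def by simp
  then show ?thesis by (intro C1_on_vec_nth smooth_on_imp_C1_on)
qed

lemma metric_symmetric_posdef:
  assumes "c \<in> A" "y \<in> chart_range c"
  shows "transpose (g c y) = g c y" "\<And>v. v \<noteq> 0 \<Longrightarrow> v \<bullet> (g c y *v v) > 0"
  using metric assms unfolding riemannian_metric_def by simp_all

lemma det_metric_pos: "c \<in> A \<Longrightarrow> y \<in> chart_range c \<Longrightarrow> det (g c y) > 0"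
  by (rule det_pos_if_positive_definite) (rule metric_symmetric_posdef)

lemma C1_on_sqrt_det_metric: "c \<in> A \<Longrightarrow> C1_on (chart_range c) (\<lambda>y. sqrt (det (g c y)))"
  by (intro C1_on_sqrt C1_on_det C1_on_metric det_metric_pos)

lemma C1_on_metric_inv: "c \<in> A \<Longrightarrow> C1_on (chart_range c) (\<lambda>y. matrix_inv (g c y) $ i $ j)"
  by (intro C1_on_matrix_inv C1_on_metric chartD) (use det_metric_pos in \<open>auto simp: less_imp_neq[symmetric]\<close>)

section \<open>The Riemannian volume: finiteness and integrals in a chart\<close>

lemma sets_vol: "sets vol = sets borel"
  using volume unfolding riemannian_volume_def by blast

lemma space_vol: "space vol = UNIV"
  using sets_eq_imp_space_eq[OF sets_vol] by simp

lemma emeasure_vol: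
  "c \<in> A \<Longrightarrow> B \<in> sets borel \<Longrightarrow> B \<subseteq> chart_domain c \<Longrightarrow>
     emeasure vol B = (\<integral>\<^sup>+x\<in>coords c ` B. ennreal (sqrt (det (g c x))) \<partial>lborel)"
  using volume unfolding riemannian_volume_def by blast

text \<open>Finitely many coordinate balls cover the manifold, and the volume density is continuous,
  hence bounded, on each closed ball. Finiteness then makes every continuous function
  integrable.\<close>

lemma finite_measure_vol: "finite_measure vol"
proof (rule finite_measureI)
  obtain P :: "'m set" and c r where P: "finite P"
    "\<And>p. p \<in> P \<Longrightarrow> c p \<in> A" "\<And>p. p \<in> P \<Longrightarrow> r p > (0::real)"
    "\<And>p. p \<in> P \<Longrightarrow> cball (coords (c p) p) (r p) \<subseteq> chart_range (c p)"
    "\<And>z. \<exists>p\<in>P. z \<in> chart_domain (c p) \<and> coords (c p) z \<in> ball (coords (c p) p) (r p)"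
    using finite_chart_balls by metis
  define U where "U p = chart_domain (c p) \<inter> coords (c p) -` ball (coords (c p) p) (r p)" for p
  have borelU: "U p \<in> sets borel" if "p \<in> P" for p
    unfolding U_def by (intro borel_open continuous_open_preimage chartD P that open_ball)
  have fin: "emeasure vol (U p) < top" if p: "p \<in> P" for p
  proof -
    let ?B = "cball (coords (c p) p) (r p)"
    have "continuous_on ?B (\<lambda>y. sqrt (det (g (c p) y)))"
      using C1_on_imp_continuous_on[OF C1_on_sqrt_det_metric[OF P(2)[OF p]]] P(4)[OF p]
      by (rule continuous_on_subset)
    then have "bounded ((\<lambda>y. sqrt (det (g (c p) y))) ` ?B)"
      by (intro compact_imp_bounded compact_continuous_image compact_cball)
    then obtain b where "\<forall>y\<in>?B. \<bar>sqrt (det (g (c p) y))\<bar> \<le> b"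
      unfolding bounded_iff by auto
    then have b: "\<bar>sqrt (det (g (c p) y))\<bar> \<le> b" if "y \<in> ?B" for y
      using that by blast
    have "emeasure vol (U p) = (\<integral>\<^sup>+x\<in>coords (c p) ` U p. ennreal (sqrt (det (g (c p) x))) \<partial>lborel)"
      by (rule emeasure_vol) (use P(2) p borelU in \<open>auto simp: U_def\<close>)
    also have "\<dots> \<le> (\<integral>\<^sup>+x. ennreal b * indicator ?B x \<partial>lborel)"
    proof (rule nn_integral_mono)
      fix x
      show "ennreal (sqrt (det (g (c p) x))) * indicator (coords (c p) ` U p) x \<le> ennreal b * indicator ?B x"
        using b[of x] by (auto simp: U_def indicator_def intro!: ennreal_leI)
    qed
    also have "\<dots> = ennreal b * emeasure lborel ?B"
      by (rule nn_integral_cmult_indicator) simp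
    also have "\<dots> < top"
      by (simp add: ennreal_mult_less_top emeasure_bounded_finite[unfolded infinity_ennreal_def])
    finally show ?thesis .
  qed
  have "emeasure vol (space vol) \<le> emeasure vol (\<Union>p\<in>P. U p)"
    by (rule emeasure_mono) (use P(5) P(1) borelU in \<open>auto simp: sets_vol U_def\<close>)
  also have "\<dots> \<le> (\<Sum>p\<in>P. emeasure vol (U p))"
    by (rule emeasure_subadditive_finite[OF P(1)]) (use borelU in \<open>auto simp: sets_vol\<close>)
  also have "\<dots> < top" using fin by (simp add: P(1))
  finally show "emeasure vol (space vol) \<noteq> \<infinity>" by simp
qed

sublocale vol: finite_measure vol
  by (rule finite_measure_vol)

lemma continuous_imp_measurable_vol:
  "continuous_on UNIV (f :: 'm \<Rightarrow> real) \<Longrightarrow> f \<in> borel_measurable vol"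
  using borel_measurable_continuous_onI by (simp add: measurable_cong_sets[OF sets_vol refl])

lemma continuous_imp_integrable_vol:
  assumes "continuous_on UNIV (f :: 'm \<Rightarrow> real)"
  shows "integrable vol f"
proof -
  obtain b where "\<And>z. \<bar>f z\<bar> \<le> b"
    using compact_imp_bounded[OF compact_continuous_image[OF assms compact_UNIV]]
    unfolding bounded_iff by auto
  then show ?thesis
    by (intro vol.integrable_const_bound[of _ b] continuous_imp_measurable_vol assms) auto
qed

text \<open>The volume is specified on Borel sets inside a chart. Integrals follow once its
  restriction to the chart domain is recognized as the image, under the inverse chart, of Lebesgue
  measure with density \<open>sqrt (det (g c y))\<close>.\<close>

lemma integral_vol_chart:
  assumes c: "c \<in> A" and F: "F \<in> borel_measurable vol" and zero: "\<And>z. z \<notin> chart_domain c \<Longrightarrow> F z = 0"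
  shows "(\<integral>z. F z \<partial>vol) =
    (\<integral>y. indicator (chart_range c) y * (sqrt (det (g c y)) * F (chart_inv c y)) \<partial>lborel)"
proof -
  let ?D = "chart_domain c" and ?R = "chart_range c"
  define \<rho> where "\<rho> y = indicator ?R y * sqrt (det (g c y))" for y
  \<comment> \<open>The inverse chart is made constant off the chart range, which gives a Borel map
    on the whole space. The constant has no influence because \<open>\<rho>\<close> vanishes
    there.\<close>
  define T where "T y = (if y \<in> ?R then chart_inv c y else undefined)" for y
  have F': "F \<in> borel_measurable borel"
    using F by (simp add: measurable_cong_sets[OF sets_vol refl])
  have \<rho>0: "\<rho> y \<ge> 0" for y
    using det_metric_pos[OF c, of y] by (auto simp: \<rho>_def indicator_def)
  have \<rho>[measurable]: "\<rho> \<in> borel_measurable borel"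
    using borel_measurable_continuous_on_indicator[OF borel_open[OF chartD(2)[OF c]]
        C1_on_imp_continuous_on[OF C1_on_sqrt_det_metric[OF c]]]
    unfolding \<rho>_def by simp
  have T[measurable]: "T \<in> borel_measurable borel"
  proof (rule borel_measurableI)
    fix S :: "'m set" assume "open S"
    have "open (?R \<inter> chart_inv c -` S)"
      by (rule continuous_open_preimage[OF chartD(4,2)[OF c] \<open>open S\<close>])
    moreover have "T -` S \<inter> space borel = (?R \<inter> chart_inv c -` S) \<union> (if undefined \<in> S then - ?R else {})"
      by (auto simp: T_def split: if_splits)
    ultimately show "T -` S \<inter> space borel \<in> sets borel"
      using chartD(2)[OF c] by (auto intro!: sets.Un borel_open borel_closed)
  qed
  have D: "?D \<in> sets borel" using chartD(1)[OF c] by simp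
  have "density vol (indicator ?D) = distr (density lborel \<rho>) borel T"
  proof (rule measure_eqI)
    show "sets (density vol (indicator ?D)) = sets (distr (density lborel \<rho>) borel T)"
      by (simp add: sets_vol)
    fix B assume "B \<in> sets (density vol (indicator ?D))"
    then have B: "B \<in> sets borel" by (simp add: sets_vol)
    have "emeasure (density vol (indicator ?D)) B = emeasure vol (?D \<inter> B)"
      by (rule emeasure_restricted) (use B D in \<open>simp_all add: sets_vol\<close>)
    also have "\<dots> = (\<integral>\<^sup>+x\<in>coords c ` (?D \<inter> B). ennreal (sqrt (det (g c x))) \<partial>lborel)"
      by (rule emeasure_vol[OF c]) (use B D in auto)
    also have "\<dots> = (\<integral>\<^sup>+x. ennreal (\<rho> x) * indicator (T -` B \<inter> space (density lborel \<rho>)) x \<partial>lborel)"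
      unfolding coords_image[OF c]
      by (intro nn_integral_cong) (auto simp: \<rho>_def T_def indicator_def)
    also have "\<dots> = emeasure (density lborel \<rho>) (T -` B \<inter> space (density lborel \<rho>))"
      using measurable_sets[OF T B] by (intro emeasure_density[symmetric]) auto
    also have "\<dots> = emeasure (distr (density lborel \<rho>) borel T) B"
      by (rule emeasure_distr[symmetric]) (use B in auto)
    finally show "emeasure (density vol (indicator ?D)) B = emeasure (distr (density lborel \<rho>) borel T) B" .
  qed
  moreover have "(\<lambda>z. ennreal (indicator ?D z)) = indicator ?D"
    by (auto simp: indicator_def)
  ultimately have eq: "density vol (\<lambda>z. ennreal (indicator ?D z)) = distr (density lborel \<rho>) borel T"
    by simp
  have "(\<integral>z. F z \<partial>vol) = (\<integral>z. indicator ?D z *\<^sub>R F z \<partial>vol)"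
    using zero by (intro Bochner_Integration.integral_cong) (auto simp: indicator_def)
  also have "\<dots> = (\<integral>z. F z \<partial>density vol (\<lambda>z. ennreal (indicator ?D z)))"
    by (rule integral_density[symmetric, OF F])
      (use D in \<open>auto simp: sets_vol intro: borel_measurable_indicator\<close>)
  also have "\<dots> = (\<integral>y. F (T y) \<partial>density lborel \<rho>)"
    unfolding eq by (rule integral_distr[OF _ F']) simp
  also have "\<dots> = (\<integral>y. \<rho> y *\<^sub>R F (T y) \<partial>lborel)"
    by (rule integral_density) (use measurable_compose[OF T F'] \<rho> \<rho>0 in auto)
  also have "\<dots> = (\<integral>y. indicator ?R y * (sqrt (det (g c y)) * F (chart_inv c y)) \<partial>lborel)"
    by (intro Bochner_Integration.integral_cong) (auto simp: \<rho>_def T_def indicator_def)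
  finally show ?thesis .
qed

end

section \<open>Green's formula\<close>

lemma matrix_inv_unique:
  fixes M N :: "real ^ 'n ^ 'n"
  assumes "M ** N = mat 1"
  shows "matrix_inv M = N"
proof -
  have "N ** M = mat 1" using assms by (simp add: matrix_left_right_inverse)
  have inv: "M ** matrix_inv M = mat 1 \<and> matrix_inv M ** M = mat 1"
    unfolding matrix_inv_def
    by (rule someI2[where a = N]) (use assms \<open>N ** M = mat 1\<close> in auto)
  have "matrix_inv M = matrix_inv M ** (M ** N)" using assms by simp
  also have "\<dots> = N" using inv by (simp add: matrix_mul_assoc)
  finally show ?thesis .
qed

lemma matrix_mul_matrix_inv:
  fixes M :: "real ^ 'n ^ 'n"
  assumes "det M \<noteq> 0"
  shows "M ** matrix_inv M = mat 1"
proof -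
  obtain N where "M ** N = mat 1" using assms by (metis invertible_det_nz invertible_right_inverse)
  then show ?thesis using matrix_inv_unique by metis
qed

text \<open>This is the transformation law of the inverse metric. Since \<open>det C\<close> is
  nonzero, so is the determinant of \<open>transpose J\<close>, which can therefore be cancelled on
  the left.\<close>

lemma matrix_inv_congruence:
  fixes C D J :: "real ^ 'n ^ 'n"
  assumes C: "C = transpose J ** D ** J" and nz: "det C \<noteq> 0"
  shows "J ** matrix_inv C ** transpose J = matrix_inv D"
proof -
  have "det (transpose J) \<noteq> 0" using nz by (simp add: C det_mul)
  then obtain L where L: "L ** transpose J = mat 1"
    by (metis invertible_det_nz invertible_left_inverse)
  have "transpose J ** (D ** (J ** matrix_inv C ** transpose J)) = C ** matrix_inv C ** transpose J"
    by (simp add: C matrix_mul_assoc)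
  also have "\<dots> = transpose J" by (simp add: matrix_mul_matrix_inv[OF nz])
  finally have "L ** transpose J ** (D ** (J ** matrix_inv C ** transpose J)) = L ** transpose J"
    by (metis matrix_mul_assoc)
  then have "D ** (J ** matrix_inv C ** transpose J) = mat 1" by (simp add: L)
  then show ?thesis by (rule matrix_inv_unique[symmetric])
qed

lemma transpose_matrix_inv:
  fixes M :: "real ^ 'n ^ 'n"
  assumes "det M \<noteq> 0" "transpose M = M"
  shows "transpose (matrix_inv M) = matrix_inv M"
proof -
  have "matrix_inv M ** M = mat 1"
    using matrix_mul_matrix_inv[OF assms(1)] by (simp add: matrix_left_right_inverse)
  then have "transpose (matrix_inv M ** M) = mat 1" by (simp add: transpose_mat)
  then have "M ** transpose (matrix_inv M) = mat 1" by (simp add: matrix_transpose_mul assms(2))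
  then show ?thesis by (rule matrix_inv_unique[symmetric])
qed

lemma linear_expansion_axis:
  fixes f :: "real ^ 'n::finite \<Rightarrow> real"
  assumes "linear f"
  shows "f v = (\<Sum>k\<in>UNIV. v $ k * f (axis k 1))"
proof -
  have "f v = f (\<Sum>k\<in>UNIV. v $ k *\<^sub>R axis k 1)"
    using basis_expansion[of v] by (simp add: scalar_mult_eq_scaleR)
  then show ?thesis by (simp add: linear_sum[OF assms] linear_scale[OF assms])
qed

lemma partial_derivI: "(f has_derivative f') (at x) \<Longrightarrow> partial_deriv i f x = f' (axis i 1)"
  unfolding partial_deriv_def using frechet_derivative_at by metis

lemma C1_on_continuous_partial: "C1_on S f \<Longrightarrow> continuous_on S (partial_deriv i f)"
  unfolding partial_deriv_def by (rule C1_on_continuous_derivative)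

section \<open>The pairing of differentials under the inverse metric\<close>

context closed_riemannian
begin

text \<open>These are the components of the differential, a covector; no index is raised with the
  metric.\<close>

definition grad :: "('m, 'n) chart \<Rightarrow> ('m \<Rightarrow> real) \<Rightarrow> 'm \<Rightarrow> real ^ 'n" where
  "grad c f z = (\<chi> i. partial_deriv i (\<lambda>y. f (chart_inv c y)) (coords c z))"

definition pairing_in :: "('m, 'n) chart \<Rightarrow> ('m \<Rightarrow> real) \<Rightarrow> ('m \<Rightarrow> real) \<Rightarrow> 'm \<Rightarrow> real" where
  "pairing_in c f h z = grad c f z \<bullet> (matrix_inv (g c (coords c z)) *v grad c h z)"

text \<open>A chart is chosen separately at each point, so that this is one function on the whole
  manifold; by \<open>pairing_in_chart_independent\<close> the choice does not matter for C^1
  arguments.\<close>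

definition pairing :: "('m \<Rightarrow> real) \<Rightarrow> ('m \<Rightarrow> real) \<Rightarrow> 'm \<Rightarrow> real" where
  "pairing f h z = pairing_in (SOME c. c \<in> A \<and> z \<in> chart_domain c) f h z"

lemma C1_manifoldD:
  "C1_manifold f \<Longrightarrow> c \<in> A \<Longrightarrow> C1_on (chart_range c) (\<lambda>y. f (chart_inv c y))"
  unfolding C1_manifold_def by blast

text \<open>The chain rule for the transition map: covectors pull back by the transposed
  Jacobian.\<close>

lemma grad_transform:
  assumes f: "C1_manifold f" and c: "c \<in> A" and d: "d \<in> A"
    and z: "z \<in> chart_domain c" "z \<in> chart_domain d"
  shows "grad c f z =
    transpose (matrix (frechet_derivative (transition c d) (at (coords c z)))) *v grad d f z"
proof -
  define S where "S = coords c ` (chart_domain c \<inter> chart_domain d)"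
  let ?a = "coords c z" and ?b = "coords d z"
  let ?T = "frechet_derivative (transition c d) (at ?a)"
  let ?fd = "\<lambda>y. f (chart_inv d y)"
  let ?F = "frechet_derivative ?fd (at ?b)"
  have S: "open S" "?a \<in> S"
    unfolding S_def using open_coords_image[OF c chartD(1)[OF d]] z by auto
  have b: "transition c d ?a = ?b"
    using chartD(7)[OF c z(1)] by (simp add: transition_def)
  have T: "(transition c d has_derivative ?T) (at ?a)"
    using C1_on_has_derivative[OF C1_on_transition[OF c d]] S(2) by (simp add: S_def)
  have F: "(?fd has_derivative ?F) (at ?b)"
    using C1_on_has_derivative[OF C1_manifoldD[OF f d]] chartD(5)[OF d z(2)] by simp
  have "((\<lambda>y. ?fd (transition c d y)) has_derivative (\<lambda>v. ?F (?T v))) (at ?a)"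
    by (rule has_derivative_compose[OF T]) (simp add: b F)
  then have *: "((\<lambda>y. f (chart_inv c y)) has_derivative (\<lambda>v. ?F (?T v))) (at ?a)"
    by (rule has_derivative_transform_within_open[OF _ S])
      (auto simp: S_def transition_def chartD(7)[OF c] chartD(7)[OF d])
  have "partial_deriv i (\<lambda>y. f (chart_inv c y)) ?a =
      (\<Sum>k\<in>UNIV. matrix ?T $ k $ i * partial_deriv k ?fd ?b)" for i
    using linear_expansion_axis[OF has_derivative_linear[OF F], of "?T (axis i 1)"]
    by (simp add: partial_derivI[OF *] partial_derivI[OF F] matrix_def)
  then show ?thesis
    by (simp add: grad_def vec_eq_iff matrix_vector_mult_def transpose_def)
qed

text \<open>The two Jacobian factors coming from the differentials are absorbed by the inverse
  metric through \<open>matrix_inv_congruence\<close>. This is what allows integrals obtained in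
  different charts to be added.\<close>

lemma pairing_in_chart_independent:
  assumes f: "C1_manifold f" and h: "C1_manifold h" and c: "c \<in> A" and d: "d \<in> A"
    and z: "z \<in> chart_domain c" "z \<in> chart_domain d"
  shows "pairing_in c f h z = pairing_in d f h z"
proof -
  define J where "J = matrix (frechet_derivative (transition c d) (at (coords c z)))"
  have "g c (coords c z) = transpose J ** g d (coords d z) ** J"
    using metric c d z unfolding riemannian_metric_def J_def Let_def by blast
  moreover have "det (g c (coords c z)) \<noteq> 0"
    using det_metric_pos[OF c chartD(5)[OF c z(1)]] by simp
  ultimately have inv: "J ** matrix_inv (g c (coords c z)) ** transpose J = matrix_inv (g d (coords d z))"
    by (rule matrix_inv_congruence)
  have "pairing_in c f h z = (transpose J *v grad d f z) \<bullet>
      (matrix_inv (g c (coords c z)) *v (transpose J *v grad d h z))"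
    unfolding pairing_in_def grad_transform[OF f c d z] grad_transform[OF h c d z] J_def ..
  also have "\<dots> = grad d f z \<bullet> (J *v (matrix_inv (g c (coords c z)) *v (transpose J *v grad d h z)))"
    by (simp add: dot_lmul_matrix)
  also have "\<dots> = grad d f z \<bullet> ((J ** matrix_inv (g c (coords c z)) ** transpose J) *v grad d h z)"
    by (simp only: matrix_vector_mul_assoc matrix_mul_assoc)
  finally show ?thesis by (simp add: inv pairing_in_def)
qed

lemma pairing_eq:
  assumes "C1_manifold f" "C1_manifold h" "c \<in> A" "z \<in> chart_domain c"
  shows "pairing f h z = pairing_in c f h z"
  unfolding pairing_def
  by (rule someI2[where a = c]) (use assms in \<open>auto intro: pairing_in_chart_independent\<close>)

lemma pairing_eq_sum:
  assumes "C1_manifold f" "C1_manifold h" and c: "c \<in> A" and y: "y \<in> chart_range c"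
  shows "pairing f h (chart_inv c y) = (\<Sum>i\<in>UNIV. partial_deriv i (\<lambda>y. f (chart_inv c y)) y *
    (\<Sum>j\<in>UNIV. matrix_inv (g c y) $ i $ j * partial_deriv j (\<lambda>y. h (chart_inv c y)) y))"
  unfolding pairing_eq[OF assms(1,2) c chartD(6)[OF c y]] pairing_in_def grad_def chartD(8)[OF c y]
  by (simp add: inner_vec_def matrix_vector_mult_def)

lemma continuous_pairing:
  assumes "C1_manifold f" "C1_manifold h"
  shows "continuous_on UNIV (pairing f h)"
proof (rule continuous_on_UNIV_local)
  fix c assume c: "c \<in> A"
  have "continuous_on (chart_range c) (\<lambda>y. \<Sum>i\<in>UNIV. partial_deriv i (\<lambda>y. f (chart_inv c y)) y *
    (\<Sum>j\<in>UNIV. matrix_inv (g c y) $ i $ j * partial_deriv j (\<lambda>y. h (chart_inv c y)) y))"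
    by (intro continuous_intros C1_on_continuous_partial C1_manifoldD assms c
        C1_on_imp_continuous_on[OF C1_on_metric_inv])
  then show "continuous_on (chart_range c) (\<lambda>y. pairing f h (chart_inv c y))"
    by (rule continuous_on_cong[THEN iffD1, rotated 2]) (auto simp: pairing_eq_sum[OF assms c])
qed

lemma pairing_commute:
  assumes "C1_manifold f" "C1_manifold h"
  shows "pairing f h z = pairing h f z"
proof -
  obtain c where c: "c \<in> A" "z \<in> chart_domain c" by (rule chart_at)
  let ?I = "matrix_inv (g c (coords c z))"
  have "transpose ?I = ?I"
    using det_metric_pos[OF c(1) chartD(5)[OF c]] metric_symmetric_posdef(1)[OF c(1) chartD(5)[OF c]]
    by (intro transpose_matrix_inv) auto
  then have "grad c f z \<bullet> (?I *v grad c h z) = grad c h z \<bullet> (?I *v grad c f z)"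
    by (metis dot_lmul_matrix inner_commute transpose_matrix_vector)
  then show ?thesis
    by (simp add: pairing_eq[OF assms c] pairing_eq[OF assms(2,1) c] pairing_in_def)
qed

lemma C1_manifold_const: "C1_manifold (\<lambda>z. k)"
  unfolding C1_manifold_def by (simp add: C1_on_const)

lemma pairing_sum_left:
  assumes w: "\<And>i. i \<in> I \<Longrightarrow> C1_manifold (w i)" and h: "C1_manifold h"
  shows "pairing (\<lambda>z. \<Sum>i\<in>I. w i z) h z = (\<Sum>i\<in>I. pairing (w i) h z)"
proof -
  obtain c where c: "c \<in> A" "z \<in> chart_domain c" by (rule chart_at)
  have s: "C1_manifold (\<lambda>z. \<Sum>i\<in>I. w i z)"
    unfolding C1_manifold_def by (intro ballI C1_on_sum C1_manifoldD w)
  have "((\<lambda>y. \<Sum>i\<in>I. w i (chart_inv c y)) has_derivative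
      (\<lambda>v. \<Sum>i\<in>I. frechet_derivative (\<lambda>y. w i (chart_inv c y)) (at (coords c z)) v)) (at (coords c z))"
    by (intro has_derivative_sum C1_on_has_derivative[OF C1_manifoldD] w c chartD)
  from partial_derivI[OF this]
  have "grad c (\<lambda>z. \<Sum>i\<in>I. w i z) z = (\<Sum>i\<in>I. grad c (w i) z)"
    by (simp add: grad_def vec_eq_iff partial_deriv_def)
  then show ?thesis
    by (simp add: pairing_eq[OF s h c] pairing_eq[OF w h c] pairing_in_def inner_sum_left)
qed

section \<open>Integration by parts against the Laplacian\<close>

definition C2_manifold :: "('m \<Rightarrow> real) \<Rightarrow> bool" where
  "C2_manifold f \<longleftrightarrow> C1_manifold f \<and>
     (\<forall>c\<in>A. \<forall>j. C1_on (chart_range c) (partial_deriv j (\<lambda>y. f (chart_inv c y))))"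

lemma C2_manifold_const: "C2_manifold (\<lambda>z. k)"
proof -
  have "partial_deriv j (\<lambda>y. k) = (\<lambda>x. 0)" for j :: 'n
    by (rule ext) (simp add: partial_derivI[OF has_derivative_const])
  then show ?thesis unfolding C2_manifold_def by (simp add: C1_manifold_const C1_on_const)
qed

text \<open>The \<open>i\<close>-th component of the Riemannian gradient of \<open>v\<close>,
  weighted by the volume density. Its Euclidean divergence is the Laplacian of \<open>v\<close>
  times that density.\<close>

definition flux :: "('m, 'n) chart \<Rightarrow> ('m \<Rightarrow> real) \<Rightarrow> 'n \<Rightarrow> real ^ 'n \<Rightarrow> real" where
  "flux c v i y = (\<Sum>j\<in>UNIV. sqrt (det (g c y)) * matrix_inv (g c y) $ i $ j *
     partial_deriv j (\<lambda>y. v (chart_inv c y)) y)"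

lemma C1_on_flux: "C2_manifold v \<Longrightarrow> c \<in> A \<Longrightarrow> C1_on (chart_range c) (flux c v i)"
  unfolding flux_def C2_manifold_def
  by (intro C1_on_sum C1_on_mult C1_on_sqrt_det_metric C1_on_metric_inv) auto

lemma laplace_beltrami_flux:
  assumes "laplace_beltrami A g v h" and c: "c \<in> A" and y: "y \<in> chart_range c"
  shows "h (chart_inv c y) = (1 / sqrt (det (g c y))) * (\<Sum>i\<in>UNIV. partial_deriv i (flux c v i) y)"
  using assms(1) c chartD(6)[OF c y] chartD(8)[OF c y]
  unfolding laplace_beltrami_def coord_laplacian_def flux_def by auto

lemma continuous_laplacian:
  assumes v: "C2_manifold v" and h: "laplace_beltrami A g v h"
  shows "continuous_on UNIV h"
proof (rule continuous_on_UNIV_local)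
  fix c assume c: "c \<in> A"
  have "continuous_on (chart_range c)
      (\<lambda>y. (1 / sqrt (det (g c y))) * (\<Sum>i\<in>UNIV. partial_deriv i (flux c v i) y))"
    by (intro continuous_intros C1_on_continuous_partial C1_on_flux v c
        C1_on_imp_continuous_on[OF C1_on_sqrt_det_metric])
      (use det_metric_pos[OF c] in force)
  then show "continuous_on (chart_range c) (\<lambda>y. h (chart_inv c y))"
    by (rule continuous_on_cong[THEN iffD1, rotated 2]) (auto simp: laplace_beltrami_flux[OF h c])
qed

text \<open>In coordinates the density of \<open>vol\<close> cancels the prefactor of the Laplacian,
  leaving \<open>w\<close> times the divergence of the flux. The product of \<open>w\<close> with
  each flux component is compactly supported in the chart range, so its partial derivative
  integrates to 0, and the product rule moves the derivative onto \<open>w\<close>.\<close>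

lemma green_chart:
  assumes w: "C1_manifold w" and v: "C2_manifold v" and h: "laplace_beltrami A g v h"
    and c: "c \<in> A" and K: "compact K" "K \<subseteq> chart_range c"
    and zero: "\<And>z. z \<notin> chart_inv c ` K \<Longrightarrow> w z = 0"
  shows "(\<integral>z. w z * h z \<partial>vol) = - (\<integral>z. pairing w v z \<partial>vol)"
proof -
  let ?R = "chart_range c"
  let ?w = "\<lambda>y. w (chart_inv c y)"
  have v1: "C1_manifold v" using v by (simp add: C2_manifold_def)
  note Cw = C1_manifoldD[OF w c] and CX = C1_on_flux[OF v c]
  have R: "open ?R" by (rule chartD[OF c])
  have Q: "closed (chart_inv c ` K)"
    by (intro compact_imp_closed compact_continuous_image K continuous_on_subset[OF chartD(4)[OF c]])
  have w0: "?w y = 0" if "y \<in> ?R" "y \<notin> K" for y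
  proof (rule zero, rule notI)
    assume "chart_inv c y \<in> chart_inv c ` K"
    then obtain k where "k \<in> K" "chart_inv c y = chart_inv c k" by blast
    then have "y = k" using chartD(8)[OF c] that(1) K(2) by (metis subsetD)
    then show False using that(2) \<open>k \<in> K\<close> by simp
  qed
  have Dw0: "partial_deriv i ?w y = 0" if y: "y \<in> ?R" "y \<notin> K" for i y
  proof -
    have "open (?R - K)" using R compact_imp_closed[OF K(1)] by (rule open_Diff)
    then have "((\<lambda>y. ?w y) has_derivative (\<lambda>v. 0)) (at y)"
      by (rule has_derivative_transform_within_open[where f = "\<lambda>y. 0", rotated]) (use y w0 in auto)
    then show ?thesis by (rule partial_derivI)
  qed
  \<comment> \<open>The two halves of the product rule, set to 0 off the chart range, where the
    values of \<open>chart_inv c\<close> carry no meaning.\<close>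
  define a where "a i y = indicator ?R y * (partial_deriv i ?w y * flux c v i y)" for i y
  define b where "b i y = indicator ?R y * (?w y * partial_deriv i (flux c v i) y)" for i y
  have a: "integrable lborel (a i)" for i
  proof (rule integrable_continuous_compact_support[OF _ K(1)])
    have "continuous_on K (\<lambda>y. partial_deriv i ?w y * flux c v i y)"
      by (rule continuous_on_subset[OF _ K(2)])
        (intro continuous_intros C1_on_continuous_partial Cw C1_on_imp_continuous_on CX)
    then show "continuous_on K (a i)"
      by (rule continuous_on_cong[THEN iffD1, rotated 2]) (use K(2) in \<open>auto simp: a_def indicator_def\<close>)
  qed (auto simp: a_def indicator_def Dw0)
  have b: "integrable lborel (b i)" for i
  proof (rule integrable_continuous_compact_support[OF _ K(1)])
    have "continuous_on K (\<lambda>y. ?w y * partial_deriv i (flux c v i) y)"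
      by (rule continuous_on_subset[OF _ K(2)])
        (intro continuous_intros C1_on_continuous_partial Cw C1_on_imp_continuous_on CX)
    then show "continuous_on K (b i)"
      by (rule continuous_on_cong[THEN iffD1, rotated 2]) (use K(2) in \<open>auto simp: b_def indicator_def\<close>)
  qed (auto simp: b_def indicator_def w0)
  have ab: "(\<integral>y. a i y \<partial>lborel) + (\<integral>y. b i y \<partial>lborel) = 0" for i
  proof -
    define F where "F y = (if y \<in> ?R then ?w y * flux c v i y else 0)" for y
    have F0: "F y = 0" if "y \<notin> K" for y using w0 that by (simp add: F_def)
    have FR: "C1_on ?R F"
      by (rule C1_on_cong[OF R C1_on_mult[OF Cw CX[of i]]]) (simp add: F_def)
    have F: "C1_on UNIV F"
      by (rule C1_on_UNIV_extend_zero[OF R FR compact_imp_closed[OF K(1)] K(2) F0])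
    have "frechet_derivative F (at y) (axis i 1) = a i y + b i y" for y
    proof (cases "y \<in> ?R")
      case True
      have "(F has_derivative (\<lambda>v'. ?w y * frechet_derivative (flux c v i) (at y) v' +
          frechet_derivative ?w (at y) v' * flux c v i y)) (at y)"
        by (rule has_derivative_transform_within_open[OF
              has_derivative_mult[OF C1_on_has_derivative[OF Cw True] C1_on_has_derivative[OF CX True]] R True])
          (simp add: F_def)
      then show ?thesis
        using True by (simp add: frechet_derivative_at[symmetric] a_def b_def partial_deriv_def)
    next
      case False
      then have "y \<notin> K" using K(2) by blast
      then show ?thesis
        using frechet_derivative_zero_outside[OF compact_imp_closed[OF K(1)] F0] False
        by (simp add: a_def b_def)
    qed
    then show ?thesis
      using integral_directional_derivative_eq_0[OF F K(1) F0, of "axis i 1"]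
      by (simp add: Bochner_Integration.integral_add[OF a b])
  qed
  have dom: "z \<in> chart_inv c ` K \<Longrightarrow> z \<in> chart_domain c" for z
    using chartD(6)[OF c] K(2) by blast
  have s: "sqrt (det (g c y)) > 0" if "y \<in> ?R" for y
    using det_metric_pos[OF c that] by simp
  have "(\<integral>z. w z * h z \<partial>vol) =
      (\<integral>y. indicator ?R y * (sqrt (det (g c y)) * (?w y * h (chart_inv c y))) \<partial>lborel)"
    by (rule integral_vol_chart[OF c])
      (use zero dom in \<open>auto intro!: continuous_imp_measurable_vol continuous_on_mult
        C1_manifold_imp_continuous[OF w] continuous_laplacian[OF v h]\<close>)
  also have "\<dots> = (\<integral>y. (\<Sum>i\<in>UNIV. b i y) \<partial>lborel)"
  proof (rule Bochner_Integration.integral_cong[OF refl])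
    fix y
    show "indicator ?R y * (sqrt (det (g c y)) * (?w y * h (chart_inv c y))) = (\<Sum>i\<in>UNIV. b i y)"
    proof (cases "y \<in> ?R")
      case True
      then show ?thesis
        using s[OF True] by (simp add: b_def laplace_beltrami_flux[OF h c True] sum_distrib_left)
    qed (simp add: b_def)
  qed
  also have "\<dots> = (\<Sum>i\<in>UNIV. \<integral>y. b i y \<partial>lborel)"
    by (intro Bochner_Integration.integral_sum b)
  also have "\<dots> = - (\<Sum>i\<in>UNIV. \<integral>y. a i y \<partial>lborel)"
    using ab by (simp add: add_eq_0_iff sum_negf)
  also have "(\<Sum>i\<in>UNIV. \<integral>y. a i y \<partial>lborel) = (\<integral>y. (\<Sum>i\<in>UNIV. a i y) \<partial>lborel)"
    by (intro Bochner_Integration.integral_sum[symmetric] a)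
  also have "\<dots> = (\<integral>y. indicator ?R y * (sqrt (det (g c y)) * pairing w v (chart_inv c y)) \<partial>lborel)"
  proof (rule Bochner_Integration.integral_cong[OF refl])
    fix y
    show "(\<Sum>i\<in>UNIV. a i y) = indicator ?R y * (sqrt (det (g c y)) * pairing w v (chart_inv c y))"
    proof (cases "y \<in> ?R")
      case True
      then show ?thesis
        by (simp add: a_def flux_def pairing_eq_sum[OF w v1 c True] sum_distrib_left mult_ac)
    qed (simp add: a_def)
  qed
  also have "\<dots> = (\<integral>z. pairing w v z \<partial>vol)"
  proof (rule integral_vol_chart[OF c, symmetric])
    \<comment> \<open>The pairing involves derivatives of \<open>w\<close>, so vanishing at
      \<open>z\<close> alone would not do: \<open>w\<close> vanishes on the open complement of the
      compact set \<open>chart_inv c\<close> followed by the image of \<open>K\<close>, and this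
      complement is a neighbourhood of \<open>z\<close>.\<close>
    show "pairing w v z = 0" if z: "z \<notin> chart_domain c" for z
    proof -
      obtain d where d: "d \<in> A" "z \<in> chart_domain d" by (rule chart_at)
      let ?S = "coords d ` (chart_domain d \<inter> - chart_inv c ` K)"
      have S: "open ?S" "coords d z \<in> ?S"
        using open_coords_image[OF d(1) open_Compl[OF Q]] d z dom by auto
      have "((\<lambda>y. w (chart_inv d y)) has_derivative (\<lambda>v. 0)) (at (coords d z))"
        by (rule has_derivative_transform_within_open[where f = "\<lambda>y. 0", OF _ S])
          (auto simp: chartD(7)[OF d(1)] zero)
      then have "grad d w z = 0" by (simp add: grad_def vec_eq_iff partial_derivI)
      then show ?thesis by (simp add: pairing_eq[OF w v1 d] pairing_in_def)
    qed
  qed (intro continuous_imp_measurable_vol continuous_pairing w v1)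
  finally show ?thesis .
qed

text \<open>Both sides are linear in \<open>u\<close>, so only \<open>u\<close> is decomposed;
  \<open>v\<close> and its Laplacian \<open>h\<close> stay whole. Each piece is handled in its own
  chart, and \<open>pairing_sum_left\<close> reassembles the right-hand side.\<close>

lemma green_first:
  assumes u: "C1_manifold u" and v: "C2_manifold v" and h: "laplace_beltrami A g v h"
  shows "(\<integral>z. u z * h z \<partial>vol) = - (\<integral>z. pairing u v z \<partial>vol)"
proof -
  obtain P :: "'m set" and c K w where P: "finite P"
    and H: "\<forall>p\<in>P. c p \<in> A \<and> compact (K p) \<and> K p \<subseteq> chart_range (c p) \<and> C1_manifold (w p) \<and>
      (\<forall>z. z \<notin> chart_inv (c p) ` K p \<longrightarrow> w p z = 0)"
    and u_eq: "\<forall>z. u z = (\<Sum>p\<in>P. w p z)"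
    using C1_manifold_decomposition[OF u] by (elim exE conjE) rule
  have w: "C1_manifold (w p)" if "p \<in> P" for p using H that by blast
  have v1: "C1_manifold v" using v by (simp add: C2_manifold_def)
  have "(\<integral>z. u z * h z \<partial>vol) = (\<integral>z. (\<Sum>p\<in>P. w p z * h z) \<partial>vol)"
    by (simp add: u_eq sum_distrib_right)
  also have "\<dots> = (\<Sum>p\<in>P. \<integral>z. w p z * h z \<partial>vol)"
    by (intro Bochner_Integration.integral_sum continuous_imp_integrable_vol continuous_on_mult
        C1_manifold_imp_continuous[OF w] continuous_laplacian[OF v h])
  also have "\<dots> = (\<Sum>p\<in>P. - (\<integral>z. pairing (w p) v z \<partial>vol))"
  proof (intro sum.cong refl)
    fix p assume p: "p \<in> P"
    show "(\<integral>z. w p z * h z \<partial>vol) = - (\<integral>z. pairing (w p) v z \<partial>vol)"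
      by (rule green_chart[OF w[OF p] v h, of "c p" "K p"]) (use H p in blast)+
  qed
  also have "\<dots> = - (\<Sum>p\<in>P. \<integral>z. pairing (w p) v z \<partial>vol)"
    by (simp add: sum_negf)
  also have "(\<Sum>p\<in>P. \<integral>z. pairing (w p) v z \<partial>vol) = (\<integral>z. (\<Sum>p\<in>P. pairing (w p) v z) \<partial>vol)"
    by (intro Bochner_Integration.integral_sum[symmetric] continuous_imp_integrable_vol continuous_pairing w v1)
  also have "(\<lambda>z. \<Sum>p\<in>P. pairing (w p) v z) = pairing (\<lambda>z. \<Sum>p\<in>P. w p z) v"
    by (rule ext) (rule pairing_sum_left[OF w v1, symmetric])
  also have "(\<lambda>z. \<Sum>p\<in>P. w p z) = u" by (rule ext) (rule u_eq[rule_format, symmetric])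
  finally show ?thesis .
qed

lemma green_second:
  assumes u: "C2_manifold u" "laplace_beltrami A g u k" and v: "C2_manifold v" "laplace_beltrami A g v h"
  shows "(\<integral>z. u z * h z \<partial>vol) = (\<integral>z. v z * k z \<partial>vol)"
proof -
  have *: "C1_manifold u" "C1_manifold v" using u v by (auto simp: C2_manifold_def)
  have "pairing u v = pairing v u" by (rule ext) (rule pairing_commute[OF *])
  then show ?thesis using green_first[OF *(1) v] green_first[OF *(2) u] by simp
qed

end

section \<open>Heat flows\<close>

lemma frechet_derivative_slice:
  fixes F :: "real \<times> 'a::real_normed_vector \<Rightarrow> real"
  assumes F: "C1_on ({0<..} \<times> R) F" and t: "t > 0" and y: "y \<in> R"
  shows "((\<lambda>y. F (t, y)) has_derivative (\<lambda>v. frechet_derivative F (at (t, y)) (0, v))) (at y)"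
    and "((\<lambda>s. F (s, y)) has_real_derivative frechet_derivative F (at (t, y)) (1, 0)) (at t)"
proof -
  have F': "(F has_derivative frechet_derivative F (at (t, y))) (at (t, y))"
    using C1_on_has_derivative[OF F] t y by simp
  have "((\<lambda>y. (t, y)) has_derivative (\<lambda>v. (0, v))) (at y)"
    by (auto intro!: derivative_eq_intros)
  from has_derivative_compose[OF this F']
  show "((\<lambda>y. F (t, y)) has_derivative (\<lambda>v. frechet_derivative F (at (t, y)) (0, v))) (at y)" .
  have "((\<lambda>s. (s, y)) has_derivative (\<lambda>h. (h, 0))) (at t)"
    by (auto intro!: derivative_eq_intros)
  from has_derivative_compose[OF this F']
  have "((\<lambda>s. F (s, y)) has_derivative (\<lambda>h. frechet_derivative F (at (t, y)) (h, 0))) (at t)" .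
  moreover have "(\<lambda>h. frechet_derivative F (at (t, y)) (h, 0)) = (*) (frechet_derivative F (at (t, y)) (1, 0))"
  proof
    fix h :: real
    have "frechet_derivative F (at (t, y)) (h *\<^sub>R (1, 0)) = h *\<^sub>R frechet_derivative F (at (t, y)) (1, 0)"
      by (rule linear_scale[OF has_derivative_linear[OF F']])
    then show "frechet_derivative F (at (t, y)) (h, 0) = frechet_derivative F (at (t, y)) (1, 0) * h"
      by (simp add: mult.commute)
  qed
  ultimately show "((\<lambda>s. F (s, y)) has_real_derivative frechet_derivative F (at (t, y)) (1, 0)) (at t)"
    by (simp only: has_field_derivative_def)
qed

lemma C1_on_slice:
  fixes F :: "real \<times> 'a::real_normed_vector \<Rightarrow> real"
  assumes F: "C1_on ({0<..} \<times> R) F" and t: "t > 0"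
  shows "C1_on R (\<lambda>y. F (t, y))"
proof (rule C1_onI[OF frechet_derivative_slice(1)[OF F t]])
  show "continuous_on R (\<lambda>y. frechet_derivative F (at (t, y)) (0, v))" for v
    by (rule continuous_on_compose2[OF C1_on_continuous_derivative[OF F]])
      (auto intro!: continuous_intros t)
qed

context closed_riemannian
begin

lemma continuous_on_time_local:
  fixes F :: "real \<Rightarrow> 'm \<Rightarrow> real"
  assumes "\<And>c. c \<in> A \<Longrightarrow> continuous_on ({0<..} \<times> chart_range c) (\<lambda>(t, y). F t (chart_inv c y))"
  shows "continuous_on ({0<..} \<times> UNIV) (\<lambda>(t, z). F t z)"
proof -
  have "continuous_on ({0<..} \<times> chart_domain c) (\<lambda>(t, z). F t z)" if c: "c \<in> A" for c
  proof -
    have "continuous_on ({0<..} \<times> chart_domain c)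
        (\<lambda>q. (\<lambda>(t, y). F t (chart_inv c y)) (fst q, coords c (snd q)))"
      by (rule continuous_on_compose2[OF assms[OF c]])
        (auto intro!: continuous_intros continuous_on_compose2[OF chartD(3)[OF c]] chartD(5)[OF c])
    then show ?thesis
      by (rule continuous_on_cong[THEN iffD1, rotated 2]) (auto simp: chartD(7)[OF c])
  qed
  then have "continuous_on (\<Union>c\<in>A. {0<..} \<times> chart_domain c) (\<lambda>(t, z). F t z)"
    by (intro continuous_on_open_UN open_Times open_greaterThan chartD)
  moreover have "(\<Union>c\<in>A. {0<..} \<times> chart_domain c) = ({0::real<..} \<times> UNIV)"
    using Un_chart_domain by auto
  ultimately show ?thesis by simp
qed

text \<open>Compactness of the manifold and of the time interval. The interval has to stay away from
  0, where no bound can be expected for Dirac data.\<close>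

lemma bounded_on_time_interval:
  fixes F :: "real \<Rightarrow> 'm \<Rightarrow> real"
  assumes F: "continuous_on ({0<..} \<times> UNIV) (\<lambda>(t, z). F t z)" and a: "a > 0"
  obtains B where "B \<ge> 0" "\<And>t z. t \<in> {a..b} \<Longrightarrow> \<bar>F t z\<bar> \<le> B"
proof -
  have "continuous_on ({a..b} \<times> UNIV) (\<lambda>(t, z). F t z)"
    by (rule continuous_on_subset[OF F]) (use a in auto)
  then have "bounded ((\<lambda>(t, z). F t z) ` ({a..b} \<times> UNIV))"
    by (intro compact_imp_bounded compact_continuous_image compact_Times compact_Icc compact_UNIV)
  then obtain B where "\<forall>q\<in>{a..b} \<times> UNIV. \<bar>case q of (t, z) \<Rightarrow> F t z\<bar> \<le> B"
    unfolding bounded_iff by auto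
  then have "\<bar>F t z\<bar> \<le> B" if "t \<in> {a..b}" for t z
    using that by auto
  then have "\<bar>F t z\<bar> \<le> \<bar>B\<bar>" if "t \<in> {a..b}" for t z
    using that by (meson abs_ge_self order_trans)
  then show ?thesis using that[of "\<bar>B\<bar>"] by simp
qed

text \<open>The initial condition is dropped, so that kernels and constants are treated alike, and
  the time derivative \<open>D\<close> is named. Joint continuity of both functions provides the
  bounds for differentiating under the integral.\<close>

definition heat_flow :: "(real \<Rightarrow> 'm \<Rightarrow> real) \<Rightarrow> (real \<Rightarrow> 'm \<Rightarrow> real) \<Rightarrow> bool" where
  "heat_flow u D \<longleftrightarrow>
     continuous_on ({0<..} \<times> UNIV) (\<lambda>(t, z). u t z) \<and>
     continuous_on ({0<..} \<times> UNIV) (\<lambda>(t, z). D t z) \<and>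
     (\<forall>t>0. C2_manifold (u t) \<and> laplace_beltrami A g (u t) (D t)) \<and>
     (\<forall>t>0. \<forall>z. ((\<lambda>s. u s z) has_real_derivative D t z) (at t))"

text \<open>\<open>deriv\<close> has an arbitrary value where no derivative exists. Joint smoothness
  in a chart turns it into a genuine derivative that is continuous in time and space.\<close>

lemma dirac_imp_heat_flow:
  assumes "dirac_heat_solution A g vol x u"
  shows "heat_flow u (\<lambda>t z. deriv (\<lambda>s. u s z) t)"
proof -
  define f where "f c = (\<lambda>(t, y). u t (chart_inv c y))" for c :: "('m, 'n) chart"
  have smooth: "smooth_on ({0<..} \<times> chart_range c) (f c)" if "c \<in> A" for c
    using assms that unfolding dirac_heat_solution_def f_def by blast
  note C1 = smooth_on_imp_C1_on[OF smooth]
  have time: "((\<lambda>s. u s (chart_inv c y)) has_real_derivative frechet_derivative (f c) (at (t, y)) (1, 0)) (at t)"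
    if "c \<in> A" "t > 0" "y \<in> chart_range c" for c t y
    using frechet_derivative_slice(2)[OF C1[OF that(1)] that(2,3)] by (simp add: f_def)
  have "continuous_on ({0<..} \<times> UNIV) (\<lambda>(t, z). u t z)"
    by (rule continuous_on_time_local) (use C1_on_imp_continuous_on[OF C1] in \<open>simp add: f_def\<close>)
  moreover have "continuous_on ({0<..} \<times> UNIV) (\<lambda>(t, z). deriv (\<lambda>s. u s z) t)"
  proof (rule continuous_on_time_local)
    fix c assume c: "c \<in> A"
    have "continuous_on ({0<..} \<times> chart_range c) (\<lambda>q. frechet_derivative (f c) (at q) (1, 0))"
      by (rule C1_on_continuous_derivative[OF C1[OF c]])
    then show "continuous_on ({0<..} \<times> chart_range c) (\<lambda>(t, y). deriv (\<lambda>s. u s (chart_inv c y)) t)"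
      by (rule continuous_on_cong[THEN iffD1, rotated 2]) (auto simp: DERIV_imp_deriv[OF time[OF c]])
  qed
  moreover have "C2_manifold (u t)" if t: "t > 0" for t
    unfolding C2_manifold_def C1_manifold_def
  proof (intro conjI ballI allI)
    fix c and j :: 'n assume c: "c \<in> A"
    show "C1_on (chart_range c) (\<lambda>y. u t (chart_inv c y))"
      using C1_on_slice[OF C1[OF c] t] by (simp add: f_def)
    \<comment> \<open>The derivative of \<open>f c\<close> in the direction
      \<open>(0, axis j 1)\<close> is again smooth in time and space jointly, so its slice at time
      \<open>t\<close> is C^1. On the chart range this slice is the \<open>j\<close>-th partial
      derivative of \<open>u t\<close>.\<close>
    have "C1_on (chart_range c) (\<lambda>y. frechet_derivative (f c) (at (t, y)) (0, axis j 1))"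
      by (rule C1_on_slice[OF smooth_on_imp_C1_on[OF smooth_on_derivative[OF smooth[OF c]]] t])
    then show "C1_on (chart_range c) (partial_deriv j (\<lambda>y. u t (chart_inv c y)))"
    proof (rule C1_on_cong[OF chartD(2)[OF c]])
      show "frechet_derivative (f c) (at (t, y)) (0, axis j 1) = partial_deriv j (\<lambda>y. u t (chart_inv c y)) y"
        if "y \<in> chart_range c" for y
        using partial_derivI[OF frechet_derivative_slice(1)[OF C1[OF c] t that], of j] by (simp add: f_def)
    qed
  qed
  moreover have "((\<lambda>s. u s z) has_real_derivative deriv (\<lambda>s. u s z) t) (at t)" if t: "t > 0" for t z
  proof -
    obtain c where c: "c \<in> A" "z \<in> chart_domain c" by (rule chart_at)
    show ?thesis
      using time[OF c(1) t chartD(5)[OF c]] by (simp add: chartD(7)[OF c] DERIV_imp_deriv)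
  qed
  ultimately show ?thesis
    using assms unfolding heat_flow_def dirac_heat_solution_def by blast
qed

lemma heat_flow_const: "heat_flow (\<lambda>t z. k) (\<lambda>t z. 0)"
proof -
  have "laplace_beltrami A g (\<lambda>z. k) (\<lambda>z. 0)"
    unfolding laplace_beltrami_def coord_laplacian_def
    by (simp add: partial_derivI[OF has_derivative_const])
  then show ?thesis by (simp add: heat_flow_def C2_manifold_const case_prod_unfold)
qed

section \<open>Integrals of products of two heat flows\<close>

lemma heat_flow_continuous: "heat_flow u D \<Longrightarrow> t > 0 \<Longrightarrow> continuous_on UNIV (u t)"
  unfolding heat_flow_def C2_manifold_def using C1_manifold_imp_continuous by blast

lemma heat_flow_continuous_deriv: "heat_flow u D \<Longrightarrow> t > 0 \<Longrightarrow> continuous_on UNIV (D t)"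
  unfolding heat_flow_def using continuous_laplacian by blast

text \<open>General affine times serve two purposes: slopes 1 and -1 move along a fixed total time,
  and slopes 1/2 and 1/2 give continuity of the midpoint integral in the total time.\<close>

lemma has_real_derivative_heat_product:
  fixes a b \<alpha> \<beta> s :: real
  assumes u: "heat_flow u D" and v: "heat_flow v E"
    and pos: "a + \<alpha> * s > 0" "b + \<beta> * s > 0"
  shows "((\<lambda>s. \<integral>z. u (a + \<alpha> * s) z * v (b + \<beta> * s) z \<partial>vol) has_real_derivative
    (\<integral>z. \<alpha> * (D (a + \<alpha> * s) z * v (b + \<beta> * s) z) + \<beta> * (u (a + \<alpha> * s) z * E (b + \<beta> * s) z) \<partial>vol)) (at s)"
proof -
  define P where "P s = a + \<alpha> * s" for s
  define Q where "Q s = b + \<beta> * s" for s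
  \<comment> \<open>On the ball of radius \<open>e\<close> each of the two times changes by at most
    \<open>\<eta>\<close>, half of the smaller one, so both stay in \<open>{\<eta>..h}\<close>. The
    summand 1 in the denominator of \<open>e\<close> covers the case of zero slopes.\<close>
  define \<eta> where "\<eta> = min (P s) (Q s) / 2"
  have \<eta>: "\<eta> > 0" using pos by (simp add: \<eta>_def P_def Q_def)
  define e where "e = \<eta> / (1 + \<bar>\<alpha>\<bar> + \<bar>\<beta>\<bar>)"
  have e: "e > 0" using \<eta> by (simp add: e_def add_pos_nonneg)
  have ee: "e * (1 + \<bar>\<alpha>\<bar> + \<bar>\<beta>\<bar>) = \<eta>"
    by (simp add: e_def add_pos_nonneg less_imp_neq[symmetric])
  define h where "h = P s + Q s + \<eta>"
  have inI: "P r \<in> {\<eta>..h}" "Q r \<in> {\<eta>..h}" if "r \<in> ball s e" for r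
  proof -
    have r: "\<bar>r - s\<bar> \<le> e" using that by (simp add: dist_real_def abs_minus_commute)
    have "\<bar>\<alpha>\<bar> * e \<le> \<eta>" "\<bar>\<beta>\<bar> * e \<le> \<eta>"
      unfolding ee[symmetric] using e by (auto simp: algebra_simps)
    moreover have "\<bar>\<alpha> * (r - s)\<bar> \<le> \<bar>\<alpha>\<bar> * e" "\<bar>\<beta> * (r - s)\<bar> \<le> \<bar>\<beta>\<bar> * e"
      using r by (auto simp: abs_mult intro: mult_left_mono)
    moreover have "P r = P s + \<alpha> * (r - s)" "Q r = Q s + \<beta> * (r - s)"
      by (simp_all add: P_def Q_def algebra_simps)
    moreover have "2 * \<eta> \<le> P s" "2 * \<eta> \<le> Q s" by (simp_all add: \<eta>_def)
    ultimately show "P r \<in> {\<eta>..h}" "Q r \<in> {\<eta>..h}"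
      using \<eta> unfolding h_def by (auto simp: abs_le_iff)
  qed
  have uv: "continuous_on ({0<..} \<times> UNIV) (\<lambda>(t, z). u t z)" "continuous_on ({0<..} \<times> UNIV) (\<lambda>(t, z). D t z)"
    "continuous_on ({0<..} \<times> UNIV) (\<lambda>(t, z). v t z)" "continuous_on ({0<..} \<times> UNIV) (\<lambda>(t, z). E t z)"
    using u v unfolding heat_flow_def by blast+
  obtain B1 where B1: "B1 \<ge> 0" "\<And>t z. t \<in> {\<eta>..h} \<Longrightarrow> \<bar>u t z\<bar> \<le> B1"
    using bounded_on_time_interval[OF uv(1) \<eta>] by metis
  obtain B2 where B2: "B2 \<ge> 0" "\<And>t z. t \<in> {\<eta>..h} \<Longrightarrow> \<bar>D t z\<bar> \<le> B2"
    using bounded_on_time_interval[OF uv(2) \<eta>] by metis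
  obtain B3 where B3: "B3 \<ge> 0" "\<And>t z. t \<in> {\<eta>..h} \<Longrightarrow> \<bar>v t z\<bar> \<le> B3"
    using bounded_on_time_interval[OF uv(3) \<eta>] by metis
  obtain B4 where B4: "B4 \<ge> 0" "\<And>t z. t \<in> {\<eta>..h} \<Longrightarrow> \<bar>E t z\<bar> \<le> B4"
    using bounded_on_time_interval[OF uv(4) \<eta>] by metis
  have PQ: "P r > 0" "Q r > 0" if "r \<in> ball s e" for r
    using inI[OF that] \<eta> by auto
  have s: "s \<in> ball s e" using e by simp
  note cont = heat_flow_continuous[OF u] heat_flow_continuous[OF v]
    heat_flow_continuous_deriv[OF u] heat_flow_continuous_deriv[OF v]
  have "((\<lambda>s. \<integral>z. u (P s) z * v (Q s) z \<partial>vol) has_real_derivative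
    (\<integral>z. \<alpha> * (D (P s) z * v (Q s) z) + \<beta> * (u (P s) z * E (Q s) z) \<partial>vol)) (at s)"
  proof (rule has_real_derivative_integral[OF e, where w = "\<lambda>z. \<bar>\<alpha>\<bar> * (B2 * B3) + \<bar>\<beta>\<bar> * (B1 * B4)"])
    fix r assume r: "r \<in> ball s e"
    show "integrable vol (\<lambda>z. u (P r) z * v (Q r) z)"
      by (intro continuous_imp_integrable_vol continuous_intros cont PQ[OF r])
    fix z
    have "((\<lambda>s. u s z) has_real_derivative D (P r) z) (at (P r))"
      "((\<lambda>s. v s z) has_real_derivative E (Q r) z) (at (Q r))"
      using u v PQ[OF r] unfolding heat_flow_def by blast+
    moreover have "(P has_real_derivative \<alpha>) (at r)" "(Q has_real_derivative \<beta>) (at r)"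
      unfolding P_def Q_def by (auto intro!: derivative_eq_intros)
    ultimately have "((\<lambda>s. u (P s) z) has_real_derivative D (P r) z * \<alpha>) (at r)"
      "((\<lambda>s. v (Q s) z) has_real_derivative E (Q r) z * \<beta>) (at r)"
      using DERIV_chain2 by blast+
    then show "((\<lambda>s. u (P s) z * v (Q s) z) has_real_derivative
        \<alpha> * (D (P r) z * v (Q r) z) + \<beta> * (u (P r) z * E (Q r) z)) (at r)"
      by (auto intro!: derivative_eq_intros simp: algebra_simps)
    have "\<bar>D (P r) z * v (Q r) z\<bar> \<le> B2 * B3" "\<bar>u (P r) z * E (Q r) z\<bar> \<le> B1 * B4"
      unfolding abs_mult using inI[OF r] by (auto intro!: mult_mono B1 B2 B3 B4)
    then have "\<bar>\<alpha> * (D (P r) z * v (Q r) z)\<bar> \<le> \<bar>\<alpha>\<bar> * (B2 * B3)"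
      "\<bar>\<beta> * (u (P r) z * E (Q r) z)\<bar> \<le> \<bar>\<beta>\<bar> * (B1 * B4)"
      by (auto simp: abs_mult[of \<alpha>] abs_mult[of \<beta>] intro!: mult_left_mono)
    then show "\<bar>\<alpha> * (D (P r) z * v (Q r) z) + \<beta> * (u (P r) z * E (Q r) z)\<bar> \<le>
        \<bar>\<alpha>\<bar> * (B2 * B3) + \<bar>\<beta>\<bar> * (B1 * B4)" by linarith
  next
    show "(\<lambda>z. \<alpha> * (D (P s) z * v (Q s) z) + \<beta> * (u (P s) z * E (Q s) z)) \<in> borel_measurable vol"
      by (intro continuous_imp_measurable_vol continuous_intros cont PQ[OF s])
  qed simp
  then show ?thesis by (simp add: P_def Q_def)
qed

text \<open>Along the times \<open>s\<close> and \<open>t - s\<close> the derivative is the integral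
  of \<open>D s z * v (t - s) z - u s z * E (t - s) z\<close>. It is 0 by
  \<open>green_second\<close>, as \<open>D\<close> and \<open>E\<close> are the Laplacians of the
  factors. The midpoint is a representative that depends on the sum alone.\<close>

lemma integral_heat_product_depends_on_sum:
  assumes u: "heat_flow u D" and v: "heat_flow v E" and pos: "s > 0" "r > 0"
  shows "(\<integral>z. u s z * v r z \<partial>vol) = (\<integral>z. u ((s + r) / 2) z * v ((s + r) / 2) z \<partial>vol)"
proof -
  define t where "t = s + r"
  define f where "f s = (\<integral>z. u (0 + 1 * s) z * v (t + (- 1) * s) z \<partial>vol)" for s
  have "(f has_real_derivative 0) (at s)" if s: "s > 0" "s < t" for s
  proof -
    have C2: "C2_manifold (u s)" "laplace_beltrami A g (u s) (D s)"
      "C2_manifold (v (t - s))" "laplace_beltrami A g (v (t - s)) (E (t - s))"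
      using u v s unfolding heat_flow_def by auto
    have int: "integrable vol (\<lambda>z. D s z * v (t - s) z)" "integrable vol (\<lambda>z. u s z * E (t - s) z)"
      using s by (intro continuous_imp_integrable_vol continuous_intros heat_flow_continuous[OF u]
        heat_flow_continuous[OF v] heat_flow_continuous_deriv[OF u] heat_flow_continuous_deriv[OF v]; simp)+
    have "(f has_real_derivative (\<integral>z. 1 * (D (0 + 1 * s) z * v (t + (- 1) * s) z) +
        (- 1) * (u (0 + 1 * s) z * E (t + (- 1) * s) z) \<partial>vol)) (at s)"
      unfolding f_def by (rule has_real_derivative_heat_product[OF u v]) (use s in auto)
    also have "(\<integral>z. 1 * (D (0 + 1 * s) z * v (t + (- 1) * s) z) +
        (- 1) * (u (0 + 1 * s) z * E (t + (- 1) * s) z) \<partial>vol) = 0"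
      using green_second[OF C2] by (simp add: Bochner_Integration.integral_diff[OF int] mult.commute)
    finally show ?thesis .
  qed
  then have "(f has_real_derivative 0) (at s within {0<..<t})" if "s \<in> {0<..<t}" for s
    using that by (auto intro: has_field_derivative_at_within)
  then have "\<exists>k. \<forall>s\<in>{0<..<t}. f s = k"
    by (intro has_field_derivative_zero_constant convex_real_interval) auto
  then have "f s = f (t / 2)" using pos unfolding t_def by fastforce
  moreover have "t + (- 1) * (t / 2) = t / 2" by simp
  moreover have "t + (- 1) * s = r" by (simp add: t_def)
  ultimately show ?thesis unfolding f_def t_def[symmetric] by simp
qed

text \<open>With \<open>I t\<close> the integral at the midpoint \<open>s = r = t / 2\<close>, the integral for times \<open>s, r\<close> is
  \<open>I (s + r)\<close>. Letting \<open>s\<close> tend to 0 for fixed \<open>r\<close> it tends to \<open>v r x\<close>, as \<open>v r\<close> is a fixed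
  continuous test function, so continuity of \<open>I\<close> gives \<open>I r = v r x\<close>.\<close>

lemma integral_dirac_heat_product:
  assumes dirac: "dirac_heat_solution A g vol x u" and v: "heat_flow v E" and pos: "s > 0" "r > 0"
  shows "(\<integral>z. u s z * v r z \<partial>vol) = v (s + r) x"
proof -
  define I where "I t = (\<integral>z. u (0 + 1/2 * t) z * v (0 + 1/2 * t) z \<partial>vol)" for t
  note u = dirac_imp_heat_flow[OF dirac]
  have I: "(\<integral>z. u s z * v r z \<partial>vol) = I (s + r)" if "s > 0" "r > 0" for s r
    using integral_heat_product_depends_on_sum[OF u v that] by (simp add: I_def)
  have "I r = v r x" if r: "r > 0" for r
  proof (rule tendsto_unique[OF trivial_limit_at_right_real])
    show "((\<lambda>s. I (s + r)) \<longlongrightarrow> v r x) (at_right 0)"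
    proof (rule Lim_transform_eventually)
      show "((\<lambda>s. \<integral>z. u s z * v r z \<partial>vol) \<longlongrightarrow> v r x) (at_right 0)"
        using dirac heat_flow_continuous[OF v r] unfolding dirac_heat_solution_def by blast
      show "\<forall>\<^sub>F s in at_right 0. (\<integral>z. u s z * v r z \<partial>vol) = I (s + r)"
        using eventually_at_right_less[of "0::real"] by eventually_elim (rule I[OF _ r])
    qed
    \<comment> \<open>Both times of \<open>I\<close> are affine in \<open>t\<close> with slope 1/2,
      so \<open>I\<close> is even differentiable at positive times.\<close>
    have "isCont I r"
      unfolding I_def by (rule DERIV_isCont[OF has_real_derivative_heat_product[OF u v]]) (use r in auto)
    then have "isCont (\<lambda>s. I (s + r)) 0"
      by (intro isCont_o2[where g = I and f = "\<lambda>s. s + r"] continuous_intros) simp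
    then show "((\<lambda>s. I (s + r)) \<longlongrightarrow> I r) (at_right 0)"
      unfolding isCont_def by (auto intro: filterlim_mono[OF _ order_refl at_le])
  qed
  then show ?thesis using I[OF pos] pos by simp
qed

end

section \<open>Cauchy-Schwarz for the sum of the kernels at half time\<close>

theorem mainTheorem2:
  fixes A :: "('m::t2_space, 'n::finite) chart set"
    and g :: "('m, 'n) metric"
    and vol :: "'m measure"
    and p :: "real \<Rightarrow> 'm \<Rightarrow> 'm \<Rightarrow> real"
    and N :: nat and x :: "nat \<Rightarrow> 'm" and t :: real
  assumes "compact_smooth_manifold A"
    and "riemannian_metric A g"
    and "riemannian_volume A g vol"
    and "heat_kernel A g vol p"
    and "N \<ge> 1" and "t > 0"
  shows "1 / (real N)\<^sup>2 * (\<Sum>m=1..N. \<Sum>n=1..N. p t (x m) (x n)) \<ge> 1 / measure vol UNIV"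
proof -
  interpret closed_riemannian A g vol
    using assms(1-3) by unfold_locales
  let ?V = "measure vol UNIV" and ?J = "{1..N}"
  define q where "q m z = p (t / 2) (x m) z" for m z
  define U where "U z = (\<Sum>m\<in>?J. q m z)" for z
  have dirac: "dirac_heat_solution A g vol y (\<lambda>t z. p t y z)" for y
    using assms(4) unfolding heat_kernel_def by blast
  note flow = dirac_imp_heat_flow[OF dirac]
  have t: "t / 2 > 0" using assms(6) by simp
  have cq: "continuous_on UNIV (q m)" for m
    unfolding q_def using heat_flow_continuous[OF flow t] .
  then have cU: "continuous_on UNIV U"
    unfolding U_def by (intro continuous_intros)
  \<comment> \<open>The factor \<open>q m\<close> carries the Dirac datum, so the other flow, with
    source \<open>x n\<close>, is evaluated at \<open>x m\<close>. The next line therefore takes the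
    factors in reversed order.\<close>
  have "(\<integral>z. q m z * q n z \<partial>vol) = p t (x n) (x m)" for m n
    using integral_dirac_heat_product[OF dirac flow t t] by (simp add: q_def)
  then have "(\<Sum>m\<in>?J. \<Sum>n\<in>?J. p t (x m) (x n)) = (\<Sum>m\<in>?J. \<Sum>n\<in>?J. \<integral>z. q n z * q m z \<partial>vol)"
    by simp
  also have "\<dots> = (\<integral>z. (\<Sum>m\<in>?J. \<Sum>n\<in>?J. q n z * q m z) \<partial>vol)"
    by (simp add: Bochner_Integration.integral_sum integrable_sum continuous_imp_integrable_vol continuous_on_mult cq)
  also have "\<dots> = (\<integral>z. (U z)\<^sup>2 \<partial>vol)"
    by (simp add: U_def power2_eq_square sum_product mult.commute)
  finally have S: "(\<Sum>m\<in>?J. \<Sum>n\<in>?J. p t (x m) (x n)) = (\<integral>z. (U z)\<^sup>2 \<partial>vol)" .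
  have "(\<integral>z. q m z \<partial>vol) = 1" for m
    using integral_dirac_heat_product[OF dirac heat_flow_const t t, of "x m" 1] by (simp add: q_def)
  then have mass: "(\<integral>z. U z \<partial>vol) = real N"
    unfolding U_def by (simp add: Bochner_Integration.integral_sum continuous_imp_integrable_vol cq)
  have "(real N)\<^sup>2 / ?V \<le> (\<integral>z. (U z)\<^sup>2 \<partial>vol)"
  proof (cases "?V = 0")
    \<comment> \<open>Division by 0 gives 0, and the integral of a square is nonnegative.\<close>
    case True
    then show ?thesis by simp
  next
    case False
    \<comment> \<open>The mean value of \<open>U\<close>. Expanding the integral of
      \<open>(U z - k)\<^sup>2\<close> with this choice gives Cauchy-Schwarz for \<open>U\<close>
      and the constant 1.\<close>
    define k where "k = real N / ?V"
    have int: "integrable vol (\<lambda>z. (U z)\<^sup>2)" "integrable vol U"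
      by (intro continuous_imp_integrable_vol continuous_intros cU)+
    have "0 \<le> (\<integral>z. (U z - k)\<^sup>2 \<partial>vol)" by simp
    also have "\<dots> = (\<integral>z. (U z)\<^sup>2 - 2 * k * U z + k\<^sup>2 \<partial>vol)"
      by (simp add: power2_diff algebra_simps)
    also have "\<dots> = (\<integral>z. (U z)\<^sup>2 \<partial>vol) - 2 * k * real N + k\<^sup>2 * ?V"
      by (simp add: int mass space_vol)
    also have "\<dots> = (\<integral>z. (U z)\<^sup>2 \<partial>vol) - (real N)\<^sup>2 / ?V"
      using False by (simp add: k_def power2_eq_square field_simps)
    finally show ?thesis by simp
  qed
  then show ?thesis
    using assms(5) unfolding S by (simp add: field_simps)
qed

end
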